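(* Assume $\bm X^\top\bm X>\underline{\mu}\,\bm I_p$ for some constant $\underline\mu>0$ (that is, $\bm X^\top\bm X-\underline{\mu}\bm I_p$ is positive definite). Let $\bm w^k=\{\bm\beta^k,\bm r^k,\bm d^k\}$ be generated by the LADMM algorithm (Algorithm 1 in the context) or the parallel LADMM algorithm (Algorithm 2 in the context) with an arbitrary initial feasible solution $\bm w^0=\{\bm\beta^0,\bm r^0,\bm d^0\}$. If $\mu>\frac{\sqrt{2n}}{\min\{c,\kappa\}}$ and $\eta>\mathrm{eigen}(\mu\bm X^\top\bm X)$, then the sequence $\bm w^k$ converges to some $\bm w^*=\{\bm\beta^*,\bm r^*,\bm d^*\}$, where $\bm w^*$ is a critical point of $L_\mu$.
   Context: Data: $\bm X\in\mathbb R^{n\times p}$, $\bm y\in\mathbb R^n$. Constants $\tau\in(0,1)$, $c>0$, $\kappa>0$, $\mu>0$, $\eta>0$. $\mathrm{eigen}(\bm A)$ denotes the maximum eigenvalue of $\bm A$. $\mathcal L_{\tau,*}:\mathbb R\to\mathbb R$ denotes either of the two smooth quantile losses: $\mathcal L_{\tau,c}(u)=\tau(u-0.5c)$ if $u\ge c$; $\frac{\tau u^2}{2c}$ if $0\le u<c$; $\frac{(1-\tau)u^2}{2c}$ if $-c\le u<0$; $(\tau-1)(u+0.5c)$ if $u<-c$; $\mathcal L_{\tau,\kappa}(u)=\tau(u-\frac{\tau\kappa}{2})$ if $u>\tau\kappa$; $\frac{u^2}{2\kappa}$ if $(\tau-1)\kappa\le u\le\tau\kappa$; $(\tau-1)[u-\frac{(\tau-1)\kappa}{2}]$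 if $u<(\tau-1)\kappa$. For a vector, $\mathcal L_{\tau,*}(\bm r)=\sum_i\mathcal L_{\tau,*}(r_i)$. Penalty: $P_\lambda(|\bm\beta|)=\sum_{j=1}^p P_\lambda(|\beta_j|)$ with, for $u\ge 0$, $P_\lambda(u)=q(u)+\frac{\lambda_2}{2}u^2$, $\lambda_1>0$, $\lambda_2\ge0$, where $q$ is one of: SCAD ($a>2$): $q(0)=0$, $q'(u)=\lambda_1$ for $u\le\lambda_1$, $q'(u)=\frac{a\lambda_1-u}{a-1}$ for $\lambda_1<u<a\lambda_1$, $q'(u)=0$ for $u\ge a\lambda_1$; MCP ($a>1$): $q(u)=\lambda_1u-\frac{u^2}{2a}$ for $u\le a\lambda_1$, $q(u)=\frac{a\lambda_1^2}{2}$ for $u>a\lambda_1$; Capped-$\ell_1$ ($a>0$): $q(u)=\lambda_1\min\{u,a\}$. (With the $\lambda_2$ term these are called Snet, Mnet, Cnet respectively.) Problem: $\min_{\bm\beta,\bm r}\mathcal L_{\tau,*}(\bm r)+P_\lambda(|\bm\beta|)$ subject to $\bm X\bm\beta+\bm r=\bm y$; feasible means this constraint holds. Augmented Lagrangian: $$L_\mu(\bm\beta,\bm r,\bm d)=\mathcal L_{\tau,*}(\bm r)+P_\lambda(|\bm\beta|)-\bm d^\top(\bm X\bm\beta+\bm r-\bm y)+\tfrac{\mu}{2}\|\bm X\bm\beta+\bm r-\bm y\|_2^2 .$$ Algorithm 1 (LADMM): with $\bm S=\eta\bm I_p-\mu\bm X^\top\bm X$ and $\|\bm v\|_{\bm S}^2=\bm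 v^\top\bm S\bm v$, for $k=0,1,2,\dots$: $\bm\beta^{k+1}\in\arg\min_{\bm\beta}\{P_\lambda(|\bm\beta|)+\frac\mu2\|\bm X\bm\beta+\bm r^k-\bm y-\bm d^k/\mu\|_2^2+\frac12\|\bm\beta-\bm\beta^k\|_{\bm S}^2\}$; $\bm r^{k+1}=\arg\min_{\bm r}\{\mathcal L_{\tau,*}(\bm r)+\frac\mu2\|\bm X\bm\beta^{k+1}+\bm r-\bm y-\bm d^k/\mu\|_2^2\}$; $\bm d^{k+1}=\bm d^k-\mu(\bm X\bm\beta^{k+1}+\bm r^{k+1}-\bm y)$. (Equivalently, $\bm\beta^{k+1}$ minimizes $P_\lambda(|\bm\beta|)+\frac\eta2\|\bm\beta-\bm\beta^k+\frac{\mu}{\eta}\bm X^\top(\bm X\bm\beta^k+\bm r^k-\bm y-\bm d^k/\mu)\|_2^2$.) Algorithm 2 (parallel LADMM): $\bm X,\bm y,\bm r,\bm d$ are split into $M$ row blocks $\bm X_m\in\mathbb R^{n_m\times p}$, $\bm y_m,\bm r_m,\bm d_m\in\mathbb R^{n_m}$, $\sum_m n_m=n$, and $\bm\beta^{k+1}\in\arg\min_{\bm\beta}\{P_\lambda(|\bm\beta|)+\frac\mu2\sum_{m=1}^M\|\bm X_m\bm\beta+\bm r_m^k-\bm y_m-\bm d_m^k/\mu\|_2^2+\frac12\|\bm\beta-\bm\beta^k\|_{\bm S}^2\}$; for $m=1,\dots,M$: $\bm r_m^{k+1}=\arg\min_{\bm r_m}\{\mathcal L_{\tau,*}(\bm r_m)+\frac\mu2\|\bm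 X_m\bm\beta^{k+1}+\bm r_m-\bm y_m-\bm d_m^k/\mu\|_2^2\}$ and $\bm d_m^{k+1}=\bm d_m^k-\mu(\bm X_m\bm\beta^{k+1}+\bm r_m^{k+1}-\bm y_m)$. A point $\bm w^*=\{\bm\beta^*,\bm r^*,\bm d^*\}$ is a critical point of $L_\mu$ if $\bm X^\top\bm d^*\in\partial P_\lambda(|\bm\beta^*|)$, $\bm d^*=\nabla\mathcal L_{\tau,*}(\bm r^* )$ and $\bm X\bm\beta^*+\bm r^*-\bm y=\bm 0$, where $\partial P_\lambda(|\cdot|)$ is the (limiting) subdifferential of $\bm\beta\mapsto P_\lambda(|\bm\beta|)$. *)

theory Defs
  imports "HOL-Analysis.Analysis"
begin

section \<open>Smooth quantile losses\<close>

definition quantile_loss_c :: "real \<Rightarrow> real \<Rightarrow> real \<Rightarrow> real" where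
  "quantile_loss_c \<tau> c u =
     (if c \<le> u then \<tau> * (u - 0.5 * c)
      else if 0 \<le> u then \<tau> * u\<^sup>2 / (2 * c)
      else if - c \<le> u then (1 - \<tau>) * u\<^sup>2 / (2 * c)
      else (\<tau> - 1) * (u + 0.5 * c))"

definition quantile_loss_kappa :: "real \<Rightarrow> real \<Rightarrow> real \<Rightarrow> real" where
  "quantile_loss_kappa \<tau> \<kappa> u =
     (if u > \<tau> * \<kappa> then \<tau> * (u - \<tau> * \<kappa> / 2)
      else if (\<tau> - 1) * \<kappa> \<le> u then u\<^sup>2 / (2 * \<kappa>)
      else (\<tau> - 1) * (u - (\<tau> - 1) * \<kappa> / 2))"

definition vec_loss :: "(real \<Rightarrow> real) \<Rightarrow> real ^ 'n \<Rightarrow> real" where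
  "vec_loss \<L> r = (\<Sum>i\<in>UNIV. \<L> (r $ i))"


section \<open>Penalties\<close>

definition scad_deriv :: "real \<Rightarrow> real \<Rightarrow> real \<Rightarrow> real" where
  "scad_deriv l1 a u =
     (if u \<le> l1 then l1
      else if u < a * l1 then (a * l1 - u) / (a - 1)
      else 0)"

text \<open>SCAD is specified by its value at 0 and its derivative; the lemmas
  \<open>scad_0\<close> and \<open>scad_has_derivative\<close> recover that specification.\<close>

definition scad :: "real \<Rightarrow> real \<Rightarrow> real \<Rightarrow> real" where
  "scad l1 a u = integral {0..u} (scad_deriv l1 a)"

lemma scad_0: "scad l1 a 0 = 0"
  by (simp add: scad_def)

lemma scad_deriv_min_max:
  assumes "l1 > 0" "a > 2"
  shows "scad_deriv l1 a u = max 0 (min l1 ((a * l1 - u) / (a - 1)))"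
proof -
  have "(a * l1 - u) / (a - 1) \<ge> l1 \<longleftrightarrow> u \<le> l1"
    using assms by (simp add: field_simps)
  moreover have "(a * l1 - u) / (a - 1) > 0 \<longleftrightarrow> u < a * l1"
    using assms by (simp add: field_simps)
  moreover have "l1 < a * l1"
    using assms by simp
  ultimately show ?thesis
    using assms unfolding scad_deriv_def min_def max_def by auto
qed

lemma scad_has_derivative:
  assumes "l1 > 0" "a > 2" "u \<ge> 0"
  shows "(scad l1 a has_real_derivative scad_deriv l1 a u) (at u within {0..})"
proof -
  have "continuous_on {0..u + 1} (scad_deriv l1 a)"
    using assms by (simp add: scad_deriv_min_max[OF assms(1,2), abs_def])
      (intro continuous_intros; simp)
  then have "((\<lambda>x. integral {0..x} (scad_deriv l1 a)) has_real_derivative scad_deriv l1 a u)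
      (at u within {0..u + 1})"
    by (rule integral_has_real_derivative) (use assms in auto)
  moreover have "at u within {0..u + 1} = at u within {0..}"
    by (rule at_within_nhd[of _ "{..<u + 1}"]) auto
  ultimately show ?thesis
    by (simp add: scad_def[abs_def])
qed

definition mcp :: "real \<Rightarrow> real \<Rightarrow> real \<Rightarrow> real" where
  "mcp l1 a u = (if u \<le> a * l1 then l1 * u - u\<^sup>2 / (2 * a) else a * l1\<^sup>2 / 2)"

definition capped_l1 :: "real \<Rightarrow> real \<Rightarrow> real \<Rightarrow> real" where
  "capped_l1 l1 a u = l1 * min u a"

definition penalty :: "(real \<Rightarrow> real) \<Rightarrow> real \<Rightarrow> real \<Rightarrow> real" where
  "penalty q l2 u = q u + l2 / 2 * u\<^sup>2"

text \<open>The map \<open>\<beta> \<mapsto> P\<^sub>\<lambda>(|\<beta>|)\<close>, with \<open>P\<close> the scalar penalty on the nonnegative reals.\<close>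

definition vec_penalty :: "(real \<Rightarrow> real) \<Rightarrow> real ^ 'p \<Rightarrow> real" where
  "vec_penalty P \<beta> = (\<Sum>j\<in>UNIV. P \<bar>\<beta> $ j\<bar>)"


section \<open>Matrices\<close>

definition positive_definite :: "real ^ 'p ^ 'p \<Rightarrow> bool" where
  "positive_definite A \<longleftrightarrow> (\<forall>v. v \<noteq> 0 \<longrightarrow> v \<bullet> (A *v v) > 0)"

text \<open>Only meaningful when \<open>A\<close> has a real eigenvalue, in particular for symmetric \<open>A\<close>.\<close>

definition max_eigenvalue :: "real ^ 'p ^ 'p \<Rightarrow> real" where
  "max_eigenvalue A = Max {l. \<exists>v. v \<noteq> 0 \<and> A *v v = l *\<^sub>R v}"

definition prox_matrix :: "real ^ 'p ^ 'n \<Rightarrow> real \<Rightarrow> real \<Rightarrow> real ^ 'p ^ 'p" where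
  "prox_matrix X \<mu> \<eta> = \<eta> *\<^sub>R mat 1 - \<mu> *\<^sub>R (transpose X ** X)"

definition quad_form :: "real ^ 'p ^ 'p \<Rightarrow> real ^ 'p \<Rightarrow> real" where
  "quad_form S v = v \<bullet> (S *v v)"


section \<open>The algorithms\<close>

definition feasible :: "real ^ 'p ^ 'n \<Rightarrow> real ^ 'n \<Rightarrow> real ^ 'p \<Rightarrow> real ^ 'n \<Rightarrow> bool" where
  "feasible X y \<beta> r \<longleftrightarrow> X *v \<beta> + r = y"

text \<open>The \<open>r\<close>-subproblem has a unique minimiser because it is strictly convex, so
  \<^const>\<open>is_arg_min\<close> also expresses the equation \<open>r = arg min\<close>.\<close>

definition ladmm ::
  "real ^ 'p ^ 'n \<Rightarrow> real ^ 'n \<Rightarrow> (real \<Rightarrow> real) \<Rightarrow> (real \<Rightarrow> real) \<Rightarrow> real \<Rightarrow> real \<Rightarrow>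
   (nat \<Rightarrow> real ^ 'p) \<Rightarrow> (nat \<Rightarrow> real ^ 'n) \<Rightarrow> (nat \<Rightarrow> real ^ 'n) \<Rightarrow> bool" where
  "ladmm X y \<L> P \<mu> \<eta> \<beta> r d \<longleftrightarrow>
     (\<forall>k.
       is_arg_min
         (\<lambda>b. vec_penalty P b
            + \<mu> / 2 * (norm (X *v b + r k - y - (1 / \<mu>) *\<^sub>R d k))\<^sup>2
            + 1 / 2 * quad_form (prox_matrix X \<mu> \<eta>) (b - \<beta> k))
         (\<lambda>_. True) (\<beta> (Suc k)) \<and>
       is_arg_min
         (\<lambda>z. vec_loss \<L> z
            + \<mu> / 2 * (norm (X *v \<beta> (Suc k) + z - y - (1 / \<mu>) *\<^sub>R d k))\<^sup>2)
         (\<lambda>_. True) (r (Suc k)) \<and>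
       d (Suc k) = d k - \<mu> *\<^sub>R (X *v \<beta> (Suc k) + r (Suc k) - y))"

text \<open>A block of rows is given by its index set \<open>I\<close>, and its matrices and vectors are stored
  in full size with zero rows outside \<open>I\<close>; thus \<open>{z. row_block I z = z}\<close> is the copy of
  \<open>\<real>\<^sup>m\<close> with \<open>m = card I\<close>. The padding contributes nothing to norms or to
  \<^const>\<open>vec_loss\<close>, as both losses vanish at 0.\<close>

definition row_block :: "'n set \<Rightarrow> ('a::zero) ^ 'n \<Rightarrow> 'a ^ 'n" where
  "row_block I v = (\<chi> i. if i \<in> I then v $ i else 0)"

definition row_partition :: "nat \<Rightarrow> (nat \<Rightarrow> 'n set) \<Rightarrow> bool" where
  "row_partition M B \<longleftrightarrow> disjoint_family_on B {1..M} \<and> (\<Union>m\<in>{1..M}. B m) = UNIV"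

definition parallel_ladmm ::
  "nat \<Rightarrow> (nat \<Rightarrow> 'n set) \<Rightarrow>
   real ^ 'p ^ 'n \<Rightarrow> real ^ 'n \<Rightarrow> (real \<Rightarrow> real) \<Rightarrow> (real \<Rightarrow> real) \<Rightarrow> real \<Rightarrow> real \<Rightarrow>
   (nat \<Rightarrow> real ^ 'p) \<Rightarrow> (nat \<Rightarrow> real ^ 'n) \<Rightarrow> (nat \<Rightarrow> real ^ 'n) \<Rightarrow> bool" where
  "parallel_ladmm M B X y \<L> P \<mu> \<eta> \<beta> r d \<longleftrightarrow>
     (let Xm = (\<lambda>m. row_block (B m) X); ym = (\<lambda>m. row_block (B m) y);
          rm = (\<lambda>m k. row_block (B m) (r k)); dm = (\<lambda>m k. row_block (B m) (d k))
      in \<forall>k.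
       is_arg_min
         (\<lambda>b. vec_penalty P b
            + \<mu> / 2 * (\<Sum>m=1..M. (norm (Xm m *v b + rm m k - ym m - (1 / \<mu>) *\<^sub>R dm m k))\<^sup>2)
            + 1 / 2 * quad_form (prox_matrix X \<mu> \<eta>) (b - \<beta> k))
         (\<lambda>_. True) (\<beta> (Suc k)) \<and>
       (\<forall>m\<in>{1..M}.
         is_arg_min
           (\<lambda>z. vec_loss \<L> z
              + \<mu> / 2 * (norm (Xm m *v \<beta> (Suc k) + z - ym m - (1 / \<mu>) *\<^sub>R dm m k))\<^sup>2)
           (\<lambda>z. row_block (B m) z = z) (rm m (Suc k)) \<and>
         dm m (Suc k) = dm m k - \<mu> *\<^sub>R (Xm m *v \<beta> (Suc k) + rm m (Suc k) - ym m)))"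


section \<open>Subdifferentials and critical points\<close>

definition regular_subdiff :: "('a::euclidean_space \<Rightarrow> real) \<Rightarrow> 'a \<Rightarrow> 'a set" where
  "regular_subdiff f x =
     {v. 0 \<le> Liminf (at x) (\<lambda>z. ereal ((f z - f x - v \<bullet> (z - x)) / norm (z - x)))}"

definition limiting_subdiff :: "('a::euclidean_space \<Rightarrow> real) \<Rightarrow> 'a \<Rightarrow> 'a set" where
  "limiting_subdiff f x =
     {v. \<exists>xs vs. xs \<longlonglongrightarrow> x \<and> (\<lambda>k. f (xs k)) \<longlonglongrightarrow> f x \<and>
           (\<forall>k. vs k \<in> regular_subdiff f (xs k)) \<and> vs \<longlonglongrightarrow> v}"

text \<open>Critical points of the augmented Lagrangian
  \<open>L(r) + P(|\<beta>|) - d\<^sup>T(X \<beta> + r - y) + \<mu>/2 |X \<beta> + r - y|\<^sup>2\<close>; the conditions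
  do not depend on \<open>\<mu>\<close>.\<close>

definition critical_point ::
  "real ^ 'p ^ 'n \<Rightarrow> real ^ 'n \<Rightarrow> (real \<Rightarrow> real) \<Rightarrow> (real \<Rightarrow> real) \<Rightarrow>
   real ^ 'p \<Rightarrow> real ^ 'n \<Rightarrow> real ^ 'n \<Rightarrow> bool" where
  "critical_point X y \<L> P \<beta> r d \<longleftrightarrow>
     transpose X *v d \<in> limiting_subdiff (vec_penalty P) \<beta> \<and>
     GDERIV (vec_loss \<L>) r :> d \<and>
     X *v \<beta> + r - y = 0"

end

theory Submission
  imports Defs
begin

text \<open>The objective \<open>G(\<beta>) = L(y - X \<beta>) + P(|\<beta>|)\<close> is piecewise quadratic, and this replaces the
  Kurdyka-Lojasiewicz argument. From the second iterate on, \<open>d = L'(r)\<close>, so \<open>|\<Delta>d|\<close> is at most a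
  multiple of \<open>|\<Delta>r|\<close>, and the augmented Lagrangian \<open>H\<close> drops in each step by at least a multiple
  of \<open>|\<Delta>\<beta>|\<^sup>2 + |\<Delta>r|\<^sup>2\<close>, while \<open>H - G(\<beta>)\<close> is bounded by a multiple of the same quantity. On every
  piece \<open>G\<close> is one of finitely many quadratics. A quadratic differs from its unique critical value by
  at most a constant times its squared gradient, and if it has no critical point then its gradient is
  bounded away from 0. Since the stationarity residual of the iterates tends to 0, all pieces visited
  infinitely often share the critical value \<open>lim G\<close>. Hence \<open>H - lim H\<close> is bounded by a multiple of its
  own decrease, so it decays geometrically and the increments are summable.\<close>

section \<open>Symmetric matrices, quadratics and convergence rates\<close>

text \<open>The penalty may be nonconvex and the iterates are not known to be bounded beforehand, so
  an error bound near a cluster point would not help. The bound used is global on each piece: its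
  constants depend only on the coefficients of the piece. The kink of \<open>P(|x|)\<close> at 0
  leaves an interval of possible slopes; such coordinates are frozen at 0 and their residual
  components dropped, which only shrinks the residual. Strictly concave kinks do no harm, because
  the \<open>\<beta>\<close>-step yields proximal subgradients and none exist there. The matrix
  \<open>S\<close> cancels the coupling through \<open>X\<close> in the \<open>\<beta>\<close>-step,
  leaving a proximal step with parameter \<open>\<eta>\<close>. The threshold on
  \<open>\<mu>\<close> comes from the dual update: with \<open>l\<close> the Lipschitz constant of
  \<open>L'\<close>, it raises \<open>H\<close> by at most \<open>l^2/\<mu> |\<Delta>r|^2\<close>,
  while the \<open>r\<close>-step lowers it by at least \<open>\<mu>/2 |\<Delta>r|^2\<close>. Hence
  the condition \<open>2 l^2 < \<mu>^2\<close>.\<close>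

lemma inner_transpose_mult:
  fixes X :: "real ^ 'p ^ 'n"
  shows "(transpose X *v u) \<bullet> v = u \<bullet> (X *v v)"
  by (simp add: dot_lmul_matrix)

text \<open>Eigenvectors to distinct eigenvalues are orthogonal, hence independent, and the
  dimension bounds their number. Finiteness is what gives the \<open>Max\<close> in
  \<open>max_eigenvalue\<close> its meaning.\<close>

lemma finite_eigenvalues_symmetric:
  fixes A :: "real ^ 'p ^ 'p"
  assumes sym: "\<And>u v. u \<bullet> (A *v v) = (A *v u) \<bullet> v"
  shows "finite {l. \<exists>v. v \<noteq> 0 \<and> A *v v = l *\<^sub>R v}"
proof -
  let ?E = "{l. \<exists>v. v \<noteq> 0 \<and> A *v v = l *\<^sub>R v}"
  define ev where "ev l = (SOME v. v \<noteq> 0 \<and> A *v v = l *\<^sub>R v)" for l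
  have ev: "ev l \<noteq> 0" "A *v ev l = l *\<^sub>R ev l" if "l \<in> ?E" for l
    using someI_ex[of "\<lambda>v. v \<noteq> 0 \<and> A *v v = l *\<^sub>R v"] that unfolding ev_def by auto
  have orth: "ev l \<bullet> ev m = 0" if "l \<in> ?E" "m \<in> ?E" "l \<noteq> m" for l m
  proof -
    have "m * (ev l \<bullet> ev m) = l * (ev l \<bullet> ev m)"
      using sym[of "ev l" "ev m"] ev that by simp
    then show ?thesis
      using that by simp
  qed
  have "inj_on ev ?E"
    by (rule inj_onI) (metis (no_types, lifting) ev(1) inner_eq_zero_iff orth)
  moreover have "independent (ev ` ?E)"
  proof (rule pairwise_orthogonal_independent)
    show "pairwise orthogonal (ev ` ?E)"
      unfolding pairwise_def orthogonal_def using orth by blast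
    show "0 \<notin> ev ` ?E"
      using ev(1) by (metis (no_types, lifting) imageE)
  qed
  then have "finite (ev ` ?E)"
    using independent_bound by blast
  ultimately show ?thesis
    using finite_imageD by blast
qed

lemma linear_coefficient_eq_0:
  fixes g h :: real
  assumes h: "h \<ge> 0" and nonneg: "\<And>t. 0 \<le> 2 * t * g + t\<^sup>2 * h"
  shows "g = 0"
proof -
  \<comment> \<open>The minimiser would be \<open>- g / h\<close>; the added 1 also covers
    \<open>h = 0\<close>.\<close>
  define t where "t = - g / (h + 1)"
  have g: "g = - t * (h + 1)"
    using h by (simp add: t_def)
  have "2 * t * g + t\<^sup>2 * h = - (t\<^sup>2 * (h + 2))"
    unfolding g by (simp add: algebra_simps power2_eq_square)
  then have "t\<^sup>2 * (h + 2) \<le> 0"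
    using nonneg[of t] by linarith
  then have "t = 0"
    using h by (simp add: mult_le_0_iff)
  then show ?thesis
    by (simp add: g)
qed

text \<open>Rayleigh's principle: the quadratic form attains its maximum \<open>l\<close> on the
  unit sphere, and a maximiser is an eigenvector with eigenvalue \<open>l\<close>.\<close>

lemma inner_le_max_eigenvalue:
  fixes A :: "real ^ 'p ^ 'p"
  assumes sym: "\<And>u v. u \<bullet> (A *v v) = (A *v u) \<bullet> v"
  shows "v \<bullet> (A *v v) \<le> max_eigenvalue A * (norm v)\<^sup>2"
proof -
  let ?f = "\<lambda>v. v \<bullet> (A *v v)"
  have "continuous_on (sphere 0 1) ?f"
    by (intro continuous_intros linear_continuous_on matrix_vector_mul_bounded_linear)
  moreover have "sphere (0 :: real ^ 'p) 1 \<noteq> {}"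
    by simp
  ultimately obtain x where x: "x \<in> sphere 0 1" and max: "\<And>u. u \<in> sphere 0 1 \<Longrightarrow> ?f u \<le> ?f x"
    using continuous_attains_sup[of "sphere (0 :: real ^ 'p) 1" ?f] compact_sphere by blast
  define l where "l = ?f x"
  have xx: "x \<bullet> x = 1"
    using x by (simp add: dot_square_norm)
  have bound: "?f u \<le> l * (u \<bullet> u)" for u
  proof (cases "u = 0")
    case False
    have "?f ((1 / norm u) *\<^sub>R u) \<le> l"
      unfolding l_def by (rule max) (use False in simp)
    moreover have "?f ((1 / norm u) *\<^sub>R u) = ?f u / (u \<bullet> u)"
      by (simp add: matrix_vector_mult_scaleR flip: power2_eq_square power2_norm_eq_inner)
    ultimately have "?f u / (u \<bullet> u) \<le> l"
      by (simp only:)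
    then show ?thesis
      using False by (simp add: pos_divide_le_eq)
  qed simp
  \<comment> \<open>First variation at the maximiser: \<open>l |z|^2 - z \<bullet> A z\<close> is
    nonnegative and vanishes at \<open>x\<close>, so its linear term along every \<open>u\<close> is
    zero.\<close>
  have "u \<bullet> (l *\<^sub>R x - A *v x) = 0" for u
  proof (rule linear_coefficient_eq_0)
    show "l * (u \<bullet> u) - ?f u \<ge> 0"
      using bound[of u] by simp
    show "0 \<le> 2 * t * (u \<bullet> (l *\<^sub>R x - A *v x)) + t\<^sup>2 * (l * (u \<bullet> u) - ?f u)" for t
    proof -
      have "x \<bullet> (A *v u) = u \<bullet> (A *v x)"
        by (metis sym inner_commute)
      then have "?f (x + t *\<^sub>R u) = l + 2 * t * (u \<bullet> (A *v x)) + t\<^sup>2 * ?f u"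
        by (simp add: l_def matrix_vector_mult_scaleR matrix_vector_right_distrib inner_add_left
            inner_add_right power2_eq_square distrib_left)
      moreover have "(x + t *\<^sub>R u) \<bullet> (x + t *\<^sub>R u) = 1 + 2 * t * (u \<bullet> x) + t\<^sup>2 * (u \<bullet> u)"
        by (simp add: xx inner_add_left inner_add_right power2_eq_square distrib_left
            inner_commute[of x u])
      ultimately have "l + 2 * t * (u \<bullet> (A *v x)) + t\<^sup>2 * ?f u
          \<le> l * (1 + 2 * t * (u \<bullet> x) + t\<^sup>2 * (u \<bullet> u))"
        using bound[of "x + t *\<^sub>R u"] by simp
      then show ?thesis
        by (simp add: inner_diff_right algebra_simps)
    qed
  qed
  then have "A *v x = l *\<^sub>R x"
    by (metis inner_eq_zero_iff right_minus_eq)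
  moreover have "x \<noteq> 0"
    using xx by auto
  ultimately have "l \<in> {l. \<exists>v. v \<noteq> 0 \<and> A *v v = l *\<^sub>R v}"
    by blast
  then have "l \<le> max_eigenvalue A"
    unfolding max_eigenvalue_def
    by (rule Max_ge[OF finite_eigenvalues_symmetric[OF sym]])
  then have "l * (v \<bullet> v) \<le> max_eigenvalue A * (v \<bullet> v)"
    by (intro mult_right_mono) auto
  with bound[of v] show ?thesis
    by (simp add: dot_square_norm)
qed

text \<open>The gradient is \<open>M x + b\<close>. It either stays away from 0, or has a zero
  \<open>z\<close>; then the value differs from that at \<open>z\<close> by a pure quadratic form in
  \<open>x - z\<close>, and \<open>M\<close> is invertible on its own range.\<close>

lemma quadratic_gradient_bound:
  fixes M :: "'a::euclidean_space \<Rightarrow> 'a"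
  assumes lin: "linear M" and sym: "\<And>x y. x \<bullet> M y = M x \<bullet> y"
  shows "\<exists>C v. \<exists>e>0. \<forall>x. norm (M x + b) < e \<longrightarrow>
           \<bar>b \<bullet> x + x \<bullet> M x / 2 - v\<bar> \<le> C * (norm (M x + b))\<^sup>2"
proof (cases "- b \<in> range M")
  case False
  have sub: "subspace (range M)"
    using lin by (simp add: linear_subspace_image)
  then have "closed (range M)"
    by (rule closed_subspace)
  then have pos: "infdist (- b) (range M) > 0"
    using False by (intro infdist_pos_not_in_closed) auto
  have "infdist (- b) (range M) \<le> norm (M x + b)" for x
    using infdist_le[of "M x" "range M" "- b"] norm_minus_cancel[of "M x + b"]
    by (simp add: dist_norm algebra_simps)
  \<comment> \<open>With \<open>e\<close> the distance of \<open>- b\<close> to the range, no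
    \<open>x\<close> has a gradient shorter than \<open>e\<close>, and the claim is vacuous.\<close>
  with pos show ?thesis
    by (metis not_less)
next
  case True
  then obtain z where z: "M z = - b"
    by (metis imageE)
  interpret linear M by fact
  have sub: "subspace (range M)"
    using lin by (simp add: linear_subspace_image)
  \<comment> \<open>Symmetry makes range and kernel orthogonal, so they meet only in 0.\<close>
  have inj: "x = 0" if x: "x \<in> range M" "M x = 0" for x
  proof -
    obtain w where "x = M w"
      using x(1) by blast
    then have "x \<bullet> x = w \<bullet> M x"
      by (metis sym)
    then show ?thesis
      using x(2) by simp
  qed
  obtain e where e: "e > 0" "\<And>x. x \<in> range M \<Longrightarrow> norm (M x) \<ge> e * norm x"
    using injective_imp_isometric[OF closed_subspace[OF sub] sub, of M] inj
      linear_conv_bounded_linear[of M] lin by blast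
  \<comment> \<open>Only the component \<open>u0\<close> in the range matters: the orthogonal part
    \<open>u1\<close> is killed by \<open>M\<close> and orthogonal to \<open>M u\<close>. On the
    range, \<open>|u0|\<close> is at most \<open>|M u| / e\<close>.\<close>
  have bound: "\<bar>u \<bullet> M u\<bar> \<le> (norm (M u))\<^sup>2 / e" for u
  proof -
    obtain u0 u1 where u: "u0 \<in> span (range M)" "\<And>w. w \<in> span (range M) \<Longrightarrow> orthogonal u1 w"
      "u = u0 + u1"
      using orthogonal_subspace_decomp_exists[of "range M" u] by metis
    have "M u1 \<bullet> M u1 = u1 \<bullet> M (M u1)"
      by (rule sym[symmetric])
    also have "\<dots> = 0"
      using u(2)[of "M (M u1)"] by (simp add: orthogonal_def span_base)
    finally have M: "M u = M u0"
      using u(3) by (simp add: add)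
    have "u1 \<bullet> M u = 0"
      using u(2)[of "M u"] by (simp add: orthogonal_def span_base)
    then have "\<bar>u \<bullet> M u\<bar> \<le> norm u0 * norm (M u)"
      using u(3) Cauchy_Schwarz_ineq2[of u0 "M u"] by (simp add: inner_left_distrib)
    also have "\<dots> \<le> norm (M u) / e * norm (M u)"
      using e(2)[of u0] u(1) e(1) M span_eq_iff[THEN iffD2, OF sub]
      by (intro mult_right_mono) (auto simp: field_simps)
    finally show ?thesis
      by (simp add: power2_eq_square)
  qed
  have eq: "b \<bullet> x + x \<bullet> M x / 2 - (b \<bullet> z + z \<bullet> M z / 2) = (x - z) \<bullet> M (x - z) / 2" for x
  proof -
    have "b = - M z"
      by (simp add: z)
    then have "b \<bullet> x = - (z \<bullet> M x)" "b \<bullet> z = - (z \<bullet> M z)" "x \<bullet> M z = z \<bullet> M x"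
      using sym[of z x] sym[of z z] by (simp_all add: inner_commute)
    then show ?thesis
      by (simp add: diff inner_diff field_simps)
  qed
  have "\<bar>b \<bullet> x + x \<bullet> M x / 2 - (b \<bullet> z + z \<bullet> M z / 2)\<bar> \<le> 1 / (2 * e) * (norm (M x + b))\<^sup>2" for x
  proof -
    have "M (x - z) = M x + b"
      by (simp add: diff z)
    then show ?thesis
      unfolding eq using bound[of "x - z"] by simp
  qed
  then show ?thesis
    by (metis zero_less_one)
qed

text \<open>Read \<open>Q p k\<close> as: iterate \<open>k\<close> fits piece \<open>p\<close>;
  \<open>w\<close> is the residual norm and \<open>g\<close> the value. A piece with
  \<open>v \<noteq> G\<close> is eventually abandoned, so its bound holds vacuously from some index
  on.\<close>

lemma finite_pieces_error_bound:
  fixes g w :: "nat \<Rightarrow> real"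
  assumes fin: "finite S" and cover: "\<And>k. \<exists>p\<in>S. Q p k"
    and piece: "\<And>p. p \<in> S \<Longrightarrow> \<exists>C v. \<exists>e>0. \<forall>k. Q p k \<and> w k < e \<longrightarrow> \<bar>g k - v\<bar> \<le> C * (w k)\<^sup>2"
    and w: "w \<longlonglongrightarrow> 0" and g: "g \<longlonglongrightarrow> G"
  shows "\<exists>C. \<forall>\<^sub>F k in sequentially. \<bar>g k - G\<bar> \<le> C * (w k)\<^sup>2"
proof -
  have "\<exists>C. \<forall>\<^sub>F k in sequentially. Q p k \<longrightarrow> \<bar>g k - G\<bar> \<le> C * (w k)\<^sup>2" if p: "p \<in> S" for p
  proof -
    obtain C v e where e: "e > 0" and C: "\<And>k. Q p k \<Longrightarrow> w k < e \<Longrightarrow> \<bar>g k - v\<bar> \<le> C * (w k)\<^sup>2"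
      using piece[OF p] by blast
    have small: "\<forall>\<^sub>F k in sequentially. w k < e"
      using order_tendstoD(2)[OF w e] .
    show ?thesis
    proof (cases "v = G")
      case True
      have "\<forall>\<^sub>F k in sequentially. Q p k \<longrightarrow> \<bar>g k - G\<bar> \<le> C * (w k)\<^sup>2"
        using small by eventually_elim (use C True in blast)
      then show ?thesis ..
    next
      case False
      \<comment> \<open>The limit is \<open>- |G - v| < 0\<close>, so the piece's error bound fails
        for all large \<open>k\<close>.\<close>
      have "(\<lambda>k. C * (w k)\<^sup>2 - \<bar>g k - v\<bar>) \<longlonglongrightarrow> C * 0\<^sup>2 - \<bar>G - v\<bar>"
        by (intro tendsto_intros w g)
      then have "\<forall>\<^sub>F k in sequentially. C * (w k)\<^sup>2 - \<bar>g k - v\<bar> < 0"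
        by (rule order_tendstoD(2)) (use False in simp)
      with small have "\<forall>\<^sub>F k in sequentially. \<not> Q p k"
        by eventually_elim (use C in force)
      then show ?thesis
        by (auto elim!: eventually_mono)
    qed
  qed
  then obtain C where C: "\<And>p. p \<in> S \<Longrightarrow>
      \<forall>\<^sub>F k in sequentially. Q p k \<longrightarrow> \<bar>g k - G\<bar> \<le> C p * (w k)\<^sup>2"
    by metis
  have "\<forall>\<^sub>F k in sequentially. \<forall>p\<in>S. Q p k \<longrightarrow> \<bar>g k - G\<bar> \<le> C p * (w k)\<^sup>2"
    using fin C by (simp add: eventually_ball_finite)
  \<comment> \<open>The constants may be negative; summing absolute values dominates each of
    them.\<close>
  then have "\<forall>\<^sub>F k in sequentially. \<bar>g k - G\<bar> \<le> (\<Sum>p\<in>S. \<bar>C p\<bar>) * (w k)\<^sup>2"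
  proof eventually_elim
    case (elim k)
    obtain p where p: "p \<in> S" "Q p k"
      using cover by blast
    have "C p \<le> (\<Sum>p\<in>S. \<bar>C p\<bar>)"
      using member_le_sum[of p S "\<lambda>p. \<bar>C p\<bar>"] p(1) fin by force
    then have "C p * (w k)\<^sup>2 \<le> (\<Sum>p\<in>S. \<bar>C p\<bar>) * (w k)\<^sup>2"
      by (intro mult_right_mono) auto
    then show ?case
      using elim p by force
  qed
  then show ?thesis
    by blast
qed

text \<open>The error bound concerns the value after the step. Combined with the decrease it gives
  \<open>h (Suc k) \<le> c * (h k - h (Suc k))\<close>, a contraction by \<open>c / (1 + c)\<close>;
  \<open>\<delta>\<close> is dominated by \<open>h / \<kappa>\<close>, so its roots are dominated by
  a geometric series.\<close>

lemma sufficient_decrease_summable: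
  fixes h \<delta> :: "nat \<Rightarrow> real"
  assumes \<delta>: "\<And>k. 0 \<le> \<delta> k" and \<kappa>: "\<kappa> > 0"
    and dec: "\<And>k. h (Suc k) + \<kappa> * \<delta> k \<le> h k"
    and nonneg: "\<And>k. 0 \<le> h k"
    and err: "\<forall>\<^sub>F k in sequentially. h (Suc k) \<le> C * \<delta> k"
  shows "summable (\<lambda>k. sqrt (\<delta> k))"
proof -
  define c where "c = max C 0 / \<kappa>"
  define \<rho> where "\<rho> = c / (1 + c)"
  have c: "c \<ge> 0"
    using \<kappa> by (simp add: c_def)
  then have \<rho>: "0 \<le> \<rho>" "\<rho> < 1"
    by (simp_all add: \<rho>_def)
  obtain N where N: "\<And>k. k \<ge> N \<Longrightarrow> h (Suc k) \<le> C * \<delta> k"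
    using err unfolding eventually_sequentially by blast
  have step: "h (Suc k) \<le> \<rho> * h k" if "k \<ge> N" for k
  proof -
    have "h (Suc k) \<le> C * \<delta> k"
      using N that by simp
    also have "\<dots> \<le> c * (\<kappa> * \<delta> k)"
      using \<delta>[of k] \<kappa> by (simp add: c_def mult_right_mono)
    also have "\<dots> \<le> c * (h k - h (Suc k))"
      using dec[of k] c by (intro mult_left_mono) auto
    finally show ?thesis
      using c by (simp add: \<rho>_def field_simps)
  qed
  have geo: "h (N + k) \<le> \<rho> ^ k * h N" for k
  proof (induction k)
    case (Suc k)
    have "h (N + Suc k) \<le> \<rho> * h (N + k)"
      using step[of "N + k"] by simp
    also have "\<dots> \<le> \<rho> * (\<rho> ^ k * h N)"
      using Suc \<rho> by (intro mult_left_mono)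
    finally show ?case
      by (simp add: mult.assoc)
  qed simp
  have le: "sqrt (\<delta> (k + N)) \<le> sqrt (h N / \<kappa>) * sqrt \<rho> ^ k" for k
  proof -
    have "\<kappa> * \<delta> (k + N) \<le> \<rho> ^ k * h N"
      using dec[of "N + k"] nonneg[of "Suc (N + k)"] geo[of k] by (simp add: add.commute)
    then have "\<delta> (k + N) \<le> h N / \<kappa> * \<rho> ^ k"
      using \<kappa> by (simp add: field_simps)
    then have "sqrt (\<delta> (k + N)) \<le> sqrt (h N / \<kappa> * \<rho> ^ k)"
      by (rule real_sqrt_le_mono)
    then show ?thesis
      by (simp only: real_sqrt_mult real_sqrt_power)
  qed
  have "summable (\<lambda>k. sqrt (h N / \<kappa>) * sqrt \<rho> ^ k)"
    using \<rho> by (intro summable_mult summable_geometric) (simp add: real_sqrt_lt_1_iff)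
  then have "summable (\<lambda>k. sqrt (\<delta> (k + N)))"
    by (rule summable_comparison_test_ev[rotated]) (use le \<delta> in auto)
  then show ?thesis
    by (rule summable_iff_shift[THEN iffD1])
qed

lemma convergent_if_summable_increments:
  fixes x :: "nat \<Rightarrow> 'a::banach"
  assumes "summable s" "\<And>k. norm (x (Suc k) - x k) \<le> s k"
  shows "convergent x"
proof -
  have "summable (\<lambda>k. x (Suc k) - x k)"
    by (rule summable_comparison_test'[of s 0]) (use assms in auto)
  then have "convergent (\<lambda>n. \<Sum>k<n. x (Suc k) - x k)"
    by (simp add: summable_iff_convergent)
  then have "convergent (\<lambda>n. (x n - x 0) + x 0)"
    unfolding sum_lessThan_telescope by (intro convergent_add) (auto simp: convergent_const)
  then show ?thesis
    by simp
qed

section \<open>Losses and penalties as piecewise quadratic functions\<close>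

definition quad_poly :: "real \<times> real \<times> real \<Rightarrow> real \<Rightarrow> real" where
  "quad_poly p u = (case p of (A, B, C) \<Rightarrow> A * u\<^sup>2 + B * u + C)"

definition quad_slope :: "real \<times> real \<times> real \<Rightarrow> real \<Rightarrow> real" where
  "quad_slope p u = (case p of (A, B, C) \<Rightarrow> 2 * A * u + B)"

text \<open>The two monotonicity conditions say that \<open>L\<close> and
  \<open>l / 2 * u\<^sup>2 - L u\<close> are convex, so one tangent inequality serves for both
  bounds, and \<open>L'\<close> is \<open>l\<close>-Lipschitz. The set \<open>T\<close> records no
  intervals: only the finite number of quadratics counts. The condition \<open>L 0 = 0\<close> makes
  zero padding of row blocks free.\<close>

definition smooth_piecewise_quadratic :: "real \<Rightarrow> (real \<Rightarrow> real) \<Rightarrow> (real \<Rightarrow> real) \<Rightarrow> bool" where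
  "smooth_piecewise_quadratic l L L' \<longleftrightarrow>
     (\<forall>u. (L has_real_derivative L' u) (at u)) \<and> mono L' \<and> mono (\<lambda>u. l * u - L' u) \<and>
     (\<forall>u. 0 \<le> L u) \<and> L 0 = 0 \<and>
     (\<exists>T. finite T \<and> (\<forall>u. \<exists>p\<in>T. L u = quad_poly p u \<and> L' u = quad_slope p u))"

text \<open>The squared positive part is continuously differentiable across its break, so losses
  built from it are differentiated without a case split.\<close>

lemma pos_part_square_has_derivative:
  "((\<lambda>x::real. (max x 0)\<^sup>2) has_real_derivative 2 * max x 0) (at x)"
proof (cases "x = 0")
  case True
  have "(\<lambda>h::real. (max h 0)\<^sup>2 / h) = (\<lambda>h. max h 0)"
    by (auto simp: fun_eq_iff max_def power2_eq_square)
  moreover have "((\<lambda>h::real. max h 0) \<longlongrightarrow> max 0 0) (at 0)"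
    by (intro tendsto_intros)
  ultimately show ?thesis
    using True by (simp add: DERIV_def)
next
  case False
  then consider "x > 0" | "x < 0"
    by linarith
  then show ?thesis
  proof cases
    case 1
    have "((\<lambda>x::real. x\<^sup>2) has_real_derivative 2 * x) (at x)"
      by (auto intro!: derivative_eq_intros)
    then have "((\<lambda>x::real. (max x 0)\<^sup>2) has_real_derivative 2 * x) (at x)"
      by (rule has_field_derivative_transform_within_open[of _ _ _ "{0<..}"]) (use 1 in auto)
    then show ?thesis
      using 1 by simp
  next
    case 2
    have "((\<lambda>x::real. 0) has_real_derivative 0) (at x)"
      by simp
    then have "((\<lambda>x::real. (max x 0)\<^sup>2) has_real_derivative 0) (at x)"
      by (rule has_field_derivative_transform_within_open[of _ _ _ "{..<0}"]) (use 2 in auto)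
    then show ?thesis
      using 2 by simp
  qed
qed

text \<open>Both quantile losses have this form, with \<open>s = t = c\<close> and with \<open>s = \<tau> \<kappa>\<close>,
  \<open>t = (1 - \<tau>) \<kappa>\<close> respectively.\<close>

definition huber_quantile_loss :: "real \<Rightarrow> real \<Rightarrow> real \<Rightarrow> real \<Rightarrow> real" where
  "huber_quantile_loss \<tau> s t u =
     \<tau> / (2 * s) * ((max u 0)\<^sup>2 - (max (u - s) 0)\<^sup>2)
     + (1 - \<tau>) / (2 * t) * ((max (- u) 0)\<^sup>2 - (max (- u - t) 0)\<^sup>2)"

definition huber_quantile_slope :: "real \<Rightarrow> real \<Rightarrow> real \<Rightarrow> real \<Rightarrow> real" where
  "huber_quantile_slope \<tau> s t u =
     \<tau> / s * (max u 0 - max (u - s) 0) - (1 - \<tau>) / t * (max (- u) 0 - max (- u - t) 0)"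

lemma smooth_piecewise_quadratic_huber:
  assumes \<tau>: "0 < \<tau>" "\<tau> < 1" and st: "s > 0" "t > 0"
    and l: "\<tau> / s \<le> l" "(1 - \<tau>) / t \<le> l"
  shows "smooth_piecewise_quadratic l (huber_quantile_loss \<tau> s t) (huber_quantile_slope \<tau> s t)"
proof -
  note sq = DERIV_chain2[OF pos_part_square_has_derivative]
  have deriv: "(huber_quantile_loss \<tau> s t has_real_derivative huber_quantile_slope \<tau> s t u) (at u)" for u
    unfolding huber_quantile_loss_def huber_quantile_slope_def
    by (rule derivative_eq_intros sq refl | use st in \<open>simp add: field_simps\<close>)+
  have mono: "0 \<le> huber_quantile_slope \<tau> s t v - huber_quantile_slope \<tau> s t u
      \<and> huber_quantile_slope \<tau> s t v - huber_quantile_slope \<tau> s t u \<le> l * (v - u)"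
    if uv: "u \<le> v" for u v
  proof -
    \<comment> \<open>\<open>a\<close> and \<open>b\<close> are the lengths of the parts of
      \<open>[u, v]\<close> inside \<open>[0, s]\<close> and \<open>[- t, 0]\<close>, the only
      regions where the slope grows, at rates \<open>\<tau> / s\<close> and
      \<open>(1 - \<tau>) / t\<close>.\<close>
    define a where "a = (max v 0 - max (v - s) 0) - (max u 0 - max (u - s) 0)"
    define b where "b = (max (- u) 0 - max (- u - t) 0) - (max (- v) 0 - max (- v - t) 0)"
    have ab: "0 \<le> a" "0 \<le> b" "a + b \<le> v - u"
      using uv st by (auto simp: a_def b_def max_def)
    have eq: "huber_quantile_slope \<tau> s t v - huber_quantile_slope \<tau> s t u = \<tau> / s * a + (1 - \<tau>) / t * b"
      by (simp add: huber_quantile_slope_def a_def b_def ring_distribs)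
    have "\<tau> / s * a \<le> l * a" "(1 - \<tau>) / t * b \<le> l * b"
      by (rule mult_right_mono[OF l(1) ab(1)], rule mult_right_mono[OF l(2) ab(2)])
    moreover have "0 < \<tau> / s"
      using \<tau> st by simp
    then have "l \<ge> 0"
      using l by linarith
    then have "l * (a + b) \<le> l * (v - u)"
      using ab by (intro mult_left_mono)
    ultimately have "\<tau> / s * a + (1 - \<tau>) / t * b \<le> l * (v - u)"
      by (simp add: distrib_left)
    moreover have "0 \<le> \<tau> / s * a + (1 - \<tau>) / t * b"
      using ab \<tau> st by simp
    ultimately show ?thesis
      using eq by simp
  qed
  have nonneg: "0 \<le> huber_quantile_loss \<tau> s t u" for u
  proof -
    have "(max (u - s) 0)\<^sup>2 \<le> (max u 0)\<^sup>2" "(max (- u - t) 0)\<^sup>2 \<le> (max (- u) 0)\<^sup>2"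
      using st by (auto intro!: power_mono)
    then show ?thesis
      using \<tau> st by (simp add: huber_quantile_loss_def)
  qed
  let ?T = "{(0, \<tau>, - \<tau> * s / 2), (\<tau> / (2 * s), 0, 0), ((1 - \<tau>) / (2 * t), 0, 0),
    (0, \<tau> - 1, (\<tau> - 1) * t / 2)}"
  have "\<exists>p\<in>?T. huber_quantile_loss \<tau> s t u = quad_poly p u \<and> huber_quantile_slope \<tau> s t u = quad_slope p u" for u
  proof -
    consider "u \<ge> s" | "0 \<le> u" "u < s" | "u < 0" "- t \<le> u" | "u < - t"
      by linarith
    then show ?thesis
      unfolding huber_quantile_loss_def huber_quantile_slope_def quad_poly_def quad_slope_def
      by cases (use st in \<open>simp_all add: field_simps power2_eq_square\<close>)
  qed
  then show ?thesis
    unfolding smooth_piecewise_quadratic_def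
    using deriv nonneg mono by (intro conjI exI[of _ ?T] monoI) (force simp: huber_quantile_loss_def algebra_simps st)+
qed

lemma quantile_loss_c_eq_huber:
  assumes "c > 0"
  shows "quantile_loss_c \<tau> c = huber_quantile_loss \<tau> c c"
proof
  fix u
  consider "u \<ge> c" | "0 \<le> u" "u < c" | "u < 0" "- c \<le> u" | "u < - c"
    by linarith
  then show "quantile_loss_c \<tau> c u = huber_quantile_loss \<tau> c c u"
    unfolding huber_quantile_loss_def quantile_loss_c_def
    by cases (use assms in \<open>simp_all add: field_simps power2_eq_square\<close>)
qed

lemma quantile_loss_kappa_eq_huber:
  assumes "0 < \<tau>" "\<tau> < 1" "\<kappa> > 0"
  shows "quantile_loss_kappa \<tau> \<kappa> = huber_quantile_loss \<tau> (\<tau> * \<kappa>) ((1 - \<tau>) * \<kappa>)"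
proof
  fix u
  define s t where "s = \<tau> * \<kappa>" and "t = (1 - \<tau>) * \<kappa>"
  have st: "s > 0" "t > 0" "(\<tau> - 1) * \<kappa> = - t"
    using assms by (simp_all add: s_def t_def algebra_simps)
  have div: "\<tau> / (2 * s) = 1 / (2 * \<kappa>)" "(1 - \<tau>) / (2 * t) = 1 / (2 * \<kappa>)"
    using assms by (simp_all add: s_def t_def)
  have eq: "quantile_loss_kappa \<tau> \<kappa> u = (if u > s then \<tau> * (u - s / 2)
      else if - t \<le> u then u\<^sup>2 / (2 * \<kappa>) else (\<tau> - 1) * (u + t / 2))"
    by (simp add: quantile_loss_kappa_def st(3) s_def)
  consider "u > s" | "u = s" | "0 \<le> u" "u < s" | "u < 0" "- t \<le> u" | "u < - t"
    by linarith
  then have "quantile_loss_kappa \<tau> \<kappa> u = huber_quantile_loss \<tau> s t u"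
  proof cases
    case 1
    then show ?thesis
      unfolding eq using st(1,2) by (simp add: huber_quantile_loss_def field_simps power2_eq_square)
  next
    case 5
    then show ?thesis
      unfolding eq using st(1,2) by (simp add: huber_quantile_loss_def field_simps power2_eq_square)
  qed (use st(1,2) eq in \<open>simp_all add: huber_quantile_loss_def div\<close>)
  then show "quantile_loss_kappa \<tau> \<kappa> u = huber_quantile_loss \<tau> (\<tau> * \<kappa>) ((1 - \<tau>) * \<kappa>) u"
    by (simp add: s_def t_def)
qed

text \<open>The curvatures are \<open>\<tau> / c\<close> and \<open>(1 - \<tau>) / c\<close> for one
  loss and \<open>1 / \<kappa>\<close> for the other; \<open>1 / min c \<kappa>\<close> dominates
  them all.\<close>

lemma smooth_piecewise_quadratic_quantile_loss:
  assumes "0 < \<tau>" "\<tau> < 1" "c > 0" "\<kappa> > 0"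
    and "L = quantile_loss_c \<tau> c \<or> L = quantile_loss_kappa \<tau> \<kappa>"
  shows "\<exists>L'. smooth_piecewise_quadratic (1 / min c \<kappa>) L L'"
proof -
  have "1 / c \<le> 1 / min c \<kappa>" "1 / \<kappa> \<le> 1 / min c \<kappa>"
    using assms by (auto intro: divide_left_mono)
  moreover have "\<tau> / c \<le> 1 / c" "(1 - \<tau>) / c \<le> 1 / c"
    using assms by (simp_all add: divide_right_mono)
  moreover have "\<tau> / (\<tau> * \<kappa>) = 1 / \<kappa>" "(1 - \<tau>) / ((1 - \<tau>) * \<kappa>) = 1 / \<kappa>"
    using assms by simp_all
  ultimately have "smooth_piecewise_quadratic (1 / min c \<kappa>) (huber_quantile_loss \<tau> c c) (huber_quantile_slope \<tau> c c)"
    "smooth_piecewise_quadratic (1 / min c \<kappa>) (huber_quantile_loss \<tau> (\<tau> * \<kappa>) ((1 - \<tau>) * \<kappa>))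
      (huber_quantile_slope \<tau> (\<tau> * \<kappa>) ((1 - \<tau>) * \<kappa>))"
    using assms by (auto intro!: smooth_piecewise_quadratic_huber)
  then show ?thesis
    using assms quantile_loss_c_eq_huber quantile_loss_kappa_eq_huber by metis
qed

text \<open>The switch \<open>s\<close> is 0 for the piece \<open>{0}\<close>, where the slope \<open>v\<close> is not determined by \<open>x\<close>.\<close>

definition piecewise_quadratic_penalty :: "(real \<Rightarrow> real) \<Rightarrow> bool" where
  "piecewise_quadratic_penalty f \<longleftrightarrow>
     continuous_on UNIV f \<and> (\<forall>x. 0 \<le> f x) \<and>
     (\<exists>T \<subseteq> {0, 1} \<times> UNIV. finite T \<and> (\<forall>x v \<eta>. (\<forall>t. f x + v * t - \<eta> / 2 * t\<^sup>2 \<le> f (x + t)) \<longrightarrow>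
        (\<exists>(s, p)\<in>T. s * x = x \<and> f x = quad_poly p x \<and> s * v = s * quad_slope p x)))"

section \<open>Proximal subgradients of the folded concave penalties\<close>

lemma nonpos_if_le_linear:
  fixes a :: real
  assumes "e > 0" and le: "\<And>t. 0 < t \<Longrightarrow> t < e \<Longrightarrow> a \<le> K * t"
  shows "a \<le> 0"
proof (rule tendsto_lowerbound)
  show "((\<lambda>t. K * t) \<longlongrightarrow> 0) (at_right 0)"
    by (auto intro!: tendsto_eq_intros)
  show "\<forall>\<^sub>F t in at_right 0. a \<le> K * t"
    using assms by (auto simp: eventually_at_right_field)
qed simp

lemma quad_poly_add: "quad_poly p (x + t) = quad_poly p x + quad_slope p x * t + fst p * t\<^sup>2"
  by (cases p) (simp add: quad_poly_def quad_slope_def power2_eq_square algebra_simps)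

text \<open>At a strictly concave kink no proximal subgradient exists, so the conclusion is vacuous there.\<close>

lemma proximal_subgradient_concave_junction:
  assumes sub: "\<And>t. f x + v * t - \<eta> / 2 * t\<^sup>2 \<le> f (x + t)" and e: "e > 0"
    and left: "\<And>u. x - e < u \<Longrightarrow> u \<le> x \<Longrightarrow> f u = quad_poly p u"
    and right: "\<And>u. x \<le> u \<Longrightarrow> u < x + e \<Longrightarrow> f u = quad_poly p' u"
    and concave: "quad_slope p' x \<le> quad_slope p x"
  shows "f x = quad_poly p x \<and> v = quad_slope p x"
proof -
  have "v - quad_slope p' x \<le> 0"
  proof (rule nonpos_if_le_linear[OF e])
    fix t :: real assume t: "0 < t" "t < e"
    have "v * t - \<eta> / 2 * t\<^sup>2 \<le> quad_slope p' x * t + fst p' * t\<^sup>2"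
      using sub[of t] right[of x] right[of "x + t"] t e by (simp add: quad_poly_add)
    then have "t * (v - quad_slope p' x) \<le> t * ((fst p' + \<eta> / 2) * t)"
      by (simp add: algebra_simps power2_eq_square)
    then show "v - quad_slope p' x \<le> (fst p' + \<eta> / 2) * t"
      using t by simp
  qed
  moreover have "quad_slope p x - v \<le> 0"
  proof (rule nonpos_if_le_linear[OF e])
    fix t :: real assume t: "0 < t" "t < e"
    have "v * (- t) - \<eta> / 2 * t\<^sup>2 \<le> quad_slope p x * (- t) + fst p * t\<^sup>2"
      using sub[of "- t"] left[of x] left[of "x + - t"] t e quad_poly_add[of p x "- t"] by simp
    then have "t * (quad_slope p x - v) \<le> t * ((fst p + \<eta> / 2) * t)"
      by (simp add: algebra_simps power2_eq_square)
    then show "quad_slope p x - v \<le> (fst p + \<eta> / 2) * t"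
      using t by simp
  qed
  ultimately show ?thesis
    using concave left[of x] e by auto
qed

text \<open>On the positive axis the junctions \<open>s1\<close> and \<open>s2\<close> are concave,
  so a proximal subgradient is the slope of a piece; the negative axis follows by reflection. Only
  at 0 can the slope be undetermined, which the switch absorbs.\<close>

lemma piecewise_quadratic_penalty_abs:
  assumes s: "0 < s1" "s1 < s2"
    and P1: "\<And>u. 0 \<le> u \<Longrightarrow> u \<le> s1 \<Longrightarrow> P u = quad_poly p1 u"
    and P2: "\<And>u. s1 \<le> u \<Longrightarrow> u \<le> s2 \<Longrightarrow> P u = quad_poly p2 u"
    and P3: "\<And>u. s2 \<le> u \<Longrightarrow> P u = quad_poly p3 u"
    and concave: "quad_slope p2 s1 \<le> quad_slope p1 s1" "quad_slope p3 s2 \<le> quad_slope p2 s2"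
    and nonneg: "\<And>u. 0 \<le> u \<Longrightarrow> 0 \<le> P u"
  shows "piecewise_quadratic_penalty (\<lambda>x. P \<bar>x\<bar>)"
proof -
  have pos: "\<exists>p\<in>{p1, p2, p3}. P \<bar>x\<bar> = quad_poly p x \<and> v = quad_slope p x"
    if x: "x > 0" and sub: "\<And>t. P \<bar>x\<bar> + v * t - \<eta> / 2 * t\<^sup>2 \<le> P \<bar>x + t\<bar>" for x v \<eta>
  proof -
    \<comment> \<open>An interior point counts as the junction of a piece with itself; at a genuine
      junction the left piece is reported.\<close>
    note * = proximal_subgradient_concave_junction[of "\<lambda>x. P \<bar>x\<bar>", OF sub]
    consider "x < s1" | "x = s1" | "s1 < x" "x < s2" | "x = s2" | "s2 < x"
      by linarith
    then show ?thesis
    proof cases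
      case 1
      then have "P \<bar>x\<bar> = quad_poly p1 x \<and> v = quad_slope p1 x"
        using x by (intro *[of "min x (s1 - x)" p1 p1]) (auto intro!: P1)
      then show ?thesis by blast
    next
      case 2
      then have "P \<bar>x\<bar> = quad_poly p1 x \<and> v = quad_slope p1 x"
        using s concave by (intro *[of "min s1 (s2 - s1)" p1 p2]) (auto intro!: P1 P2)
      then show ?thesis by blast
    next
      case 3
      then have "P \<bar>x\<bar> = quad_poly p2 x \<and> v = quad_slope p2 x"
        using x s by (intro *[of "min (x - s1) (s2 - x)" p2 p2]) (auto intro!: P2)
      then show ?thesis by blast
    next
      case 4
      then have "P \<bar>x\<bar> = quad_poly p2 x \<and> v = quad_slope p2 x"
        using s concave by (intro *[of "s2 - s1" p2 p3]) (auto intro!: P2 P3)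
      then show ?thesis by blast
    next
      case 5
      then have "P \<bar>x\<bar> = quad_poly p3 x \<and> v = quad_slope p3 x"
        using x s by (intro *[of "x - s2" p3 p3]) (auto intro!: P3)
      then show ?thesis by blast
    qed
  qed
  define mirror where "mirror p = (case p of (A, B, C) \<Rightarrow> (A, - B, C))" for p :: "real \<times> real \<times> real"
  have mirror: "quad_poly (mirror p) x = quad_poly p (- x)" "quad_slope (mirror p) x = - quad_slope p (- x)" for p x
    by (cases p; simp add: mirror_def quad_poly_def quad_slope_def)+
  \<comment> \<open>The first entry is the point piece \<open>{0}\<close>: switch 0 and constant
    value \<open>P 0\<close>.\<close>
  let ?T = "insert (0, (0, 0, P 0)) ({1} \<times> ({p1, p2, p3} \<union> mirror ` {p1, p2, p3}))"
  have "\<exists>(s, p)\<in>?T. s * x = x \<and> P \<bar>x\<bar> = quad_poly p x \<and> s * v = s * quad_slope p x"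
    if sub: "\<forall>t. P \<bar>x\<bar> + v * t - \<eta> / 2 * t\<^sup>2 \<le> P \<bar>x + t\<bar>" for x v \<eta>
  proof -
    consider "x = 0" | "x > 0" | "x < 0"
      by linarith
    then show ?thesis
    proof cases
      case 1
      then show ?thesis
        by (simp add: quad_poly_def)
    next
      case 2
      then obtain p where "p \<in> {p1, p2, p3}" "P \<bar>x\<bar> = quad_poly p x" "v = quad_slope p x"
        using pos[of x v \<eta>] sub by blast
      then show ?thesis
        by (intro bexI[of _ "(1, p)"]) auto
    next
      case 3
      have "P \<bar>- x\<bar> + - v * t - \<eta> / 2 * t\<^sup>2 \<le> P \<bar>- x + t\<bar>" for t
        using sub[rule_format, of "- t"] abs_minus_commute[of x t] by simp
      then obtain p where "p \<in> {p1, p2, p3}" "P \<bar>- x\<bar> = quad_poly p (- x)" "- v = quad_slope p (- x)"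
        using pos[of "- x" "- v" \<eta>] 3 by (meson neg_0_less_iff_less)
      then show ?thesis
        by (intro bexI[of _ "(1, mirror p)"]) (auto simp: mirror)
    qed
  qed
  moreover have "?T \<subseteq> {0, 1} \<times> UNIV" "finite ?T"
    by auto
  moreover have "continuous_on UNIV (\<lambda>x. P \<bar>x\<bar>)"
  proof (rule continuous_on_compose2[of "{0..}" P])
    have quad: "continuous_on S (quad_poly p)" for S p
      by (cases p) (auto simp: quad_poly_def[abs_def] intro!: continuous_intros)
    have eq: "{0..} = {0..s1} \<union> ({s1..s2} \<union> {s2..})"
      using s by auto
    show "continuous_on {0..} P"
      unfolding eq
    proof (intro continuous_on_closed_Un closed_Un)
      show "continuous_on {0..s1} P" "continuous_on {s1..s2} P" "continuous_on {s2..} P"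
        using P1 P2 P3 by (auto intro: continuous_on_cong[THEN iffD1, OF refl _ quad])
    qed auto
  qed (auto intro!: continuous_intros)
  ultimately show ?thesis
    unfolding piecewise_quadratic_penalty_def using nonneg
    by (intro conjI exI[of _ ?T]) auto
qed

text \<open>The ridge term shifts both one-sided slopes at a junction by the same
  \<open>l2 * u\<close>, so concavity of the junctions is inherited from \<open>q\<close>.\<close>

lemma piecewise_quadratic_penalty_ridge:
  assumes s: "0 < s1" "s1 < s2" and l2: "l2 \<ge> 0"
    and q: "\<And>u. 0 \<le> u \<Longrightarrow> u \<le> s1 \<Longrightarrow> q u = quad_poly p1 u"
      "\<And>u. s1 \<le> u \<Longrightarrow> u \<le> s2 \<Longrightarrow> q u = quad_poly p2 u"
      "\<And>u. s2 \<le> u \<Longrightarrow> q u = quad_poly p3 u"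
    and concave: "quad_slope p2 s1 \<le> quad_slope p1 s1" "quad_slope p3 s2 \<le> quad_slope p2 s2"
    and nonneg: "\<And>u. 0 \<le> u \<Longrightarrow> 0 \<le> q u"
  shows "piecewise_quadratic_penalty (\<lambda>x. penalty q l2 \<bar>x\<bar>)"
proof -
  define ridge where "ridge p = (case p of (A, B, C) \<Rightarrow> (A + l2 / 2, B, C))"
    for p :: "real \<times> real \<times> real"
  have ridge: "quad_poly (ridge p) u = quad_poly p u + l2 / 2 * u\<^sup>2"
    "quad_slope (ridge p) u = quad_slope p u + l2 * u" for p u
    by (cases p; simp add: ridge_def quad_poly_def quad_slope_def algebra_simps)+
  show ?thesis
    by (rule piecewise_quadratic_penalty_abs[OF s, of _ "ridge p1" "ridge p2" "ridge p3"])
      (use q concave nonneg l2 in \<open>auto simp: penalty_def ridge\<close>)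
qed

lemma affine_derivative_imp_quad_poly:
  assumes "convex S"
    and "\<And>u. u \<in> S \<Longrightarrow> (q has_real_derivative 2 * A * u + B) (at u within S)"
  shows "\<exists>C. \<forall>u\<in>S. q u = quad_poly (A, B, C) u"
proof -
  have "((\<lambda>u. q u - (A * u\<^sup>2 + B * u)) has_real_derivative 0) (at u within S)" if "u \<in> S" for u
    using assms(2)[OF that] by (auto intro!: derivative_eq_intros)
  then have "\<exists>C. \<forall>u\<in>S. q u - (A * u\<^sup>2 + B * u) = C"
    by (rule has_field_derivative_zero_constant[OF assms(1)])
  then obtain C where C: "\<And>u. u \<in> S \<Longrightarrow> q u - (A * u\<^sup>2 + B * u) = C"
    by blast
  have "q u = quad_poly (A, B, C) u" if "u \<in> S" for u
    using C[OF that] by (simp add: quad_poly_def)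
  then show ?thesis
    by blast
qed

lemma piecewise_quadratic_scad:
  assumes "l1 > 0" "l2 \<ge> 0" "a > 2"
  shows "piecewise_quadratic_penalty (\<lambda>x. penalty (scad l1 a) l2 \<bar>x\<bar>)"
proof -
  have s: "0 < l1" "l1 < a * l1"
    using assms by auto
  have deriv: "(scad l1 a has_real_derivative D) (at u within S)"
    if "S \<subseteq> {0..}" "u \<in> S" "scad_deriv l1 a u = D" for S u D
    using has_field_derivative_subset[OF scad_has_derivative that(1), of l1 a u] that assms by auto
  have 1: "\<exists>C. \<forall>u\<in>{0..l1}. scad l1 a u = quad_poly (0, l1, C) u"
    by (rule affine_derivative_imp_quad_poly) (use assms in \<open>auto intro!: deriv simp: scad_deriv_def\<close>)
  have 2: "\<exists>C. \<forall>u\<in>{l1..a * l1}. scad l1 a u = quad_poly (- 1 / (a - 1) / 2, a * l1 / (a - 1), C) u"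
  proof (rule affine_derivative_imp_quad_poly)
    fix u assume u: "u \<in> {l1..a * l1}"
    \<comment> \<open>The middle branch takes the value \<open>l1\<close> at its left end too, so
      its formula holds on the closed interval.\<close>
    have "(a * l1 - l1) / (a - 1) = l1"
      using assms by (simp add: field_simps)
    then have "scad_deriv l1 a u = (a * l1 - u) / (a - 1)"
      using u s by (auto simp: scad_deriv_def)
    also have "\<dots> = 2 * (- 1 / (a - 1) / 2) * u + a * l1 / (a - 1)"
      using assms by (simp add: divide_simps) (simp add: algebra_simps)
    finally have "scad_deriv l1 a u = 2 * (- 1 / (a - 1) / 2) * u + a * l1 / (a - 1)" .
    then show "(scad l1 a has_real_derivative 2 * (- 1 / (a - 1) / 2) * u + a * l1 / (a - 1))
        (at u within {l1..a * l1})"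
      using assms u by (intro deriv) auto
  qed simp
  have 3: "\<exists>C. \<forall>u\<in>{a * l1..}. scad l1 a u = quad_poly (0, 0, C) u"
  proof (rule affine_derivative_imp_quad_poly)
    fix u assume u: "u \<in> {a * l1..}"
    then have "l1 < u"
      using less_le_trans[OF s(2)] by blast
    then have "scad_deriv l1 a u = 2 * 0 * u + 0"
      using u by (simp add: scad_deriv_def)
    then show "(scad l1 a has_real_derivative 2 * 0 * u + 0) (at u within {a * l1..})"
      using \<open>l1 < u\<close> u s by (intro deriv) (auto intro: order_trans[of 0 "a * l1"])
  qed simp
  obtain C1 C2 C3 where C: "\<forall>u\<in>{0..l1}. scad l1 a u = quad_poly (0, l1, C1) u"
    "\<forall>u\<in>{l1..a * l1}. scad l1 a u = quad_poly (- 1 / (a - 1) / 2, a * l1 / (a - 1), C2) u"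
    "\<forall>u\<in>{a * l1..}. scad l1 a u = quad_poly (0, 0, C3) u"
    using 1 2 3 by blast
  have "0 \<le> scad l1 a u" for u
  \<comment> \<open>In the non-integrable case \<open>integral\<close> has the default value 0,
    which spares an integrability proof.\<close>
  proof (cases "scad_deriv l1 a integrable_on {0..u}")
    case True
    then show ?thesis
      unfolding scad_def using assms by (auto intro!: integral_nonneg simp: scad_deriv_min_max)
  qed (simp add: scad_def not_integrable_integral)
  moreover have "quad_slope (- 1 / (a - 1) / 2, a * l1 / (a - 1), C2) l1 = l1"
    "quad_slope (- 1 / (a - 1) / 2, a * l1 / (a - 1), C2) (a * l1) = 0"
    using assms by (simp_all add: quad_slope_def divide_simps) (simp_all add: algebra_simps)
  ultimately show ?thesis
    using C by (intro piecewise_quadratic_penalty_ridge[OF s assms(2), of _ "(0, l1, C1)"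
          "(- 1 / (a - 1) / 2, a * l1 / (a - 1), C2)" "(0, 0, C3)"])
      (auto simp: quad_slope_def[of "(0, _)"])
qed

text \<open>There is one genuine junction, at \<open>a * l1\<close>, where both slopes are 0; the
  second, at twice that point, is a dummy between two copies of the flat piece.\<close>

lemma piecewise_quadratic_mcp:
  assumes "l1 > 0" "l2 \<ge> 0" "a > 1"
  shows "piecewise_quadratic_penalty (\<lambda>x. penalty (mcp l1 a) l2 \<bar>x\<bar>)"
proof -
  define s where "s = a * l1"
  have s: "0 < s"
    using assms by (simp add: s_def)
  have flat: "mcp l1 a u = quad_poly (0, 0, a * l1\<^sup>2 / 2) u" if "s \<le> u" for u
    using that assms
    by (cases "u = s") (auto simp: mcp_def s_def quad_poly_def field_simps power2_eq_square)
  have "0 \<le> mcp l1 a u" if u: "0 \<le> u" for u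
  proof (cases "u \<le> s")
    case True
    have "u * (u / (2 * a)) \<le> u * l1"
      using True u assms by (intro mult_left_mono) (auto simp: s_def field_simps)
    then show ?thesis
      using True by (simp add: mcp_def s_def power2_eq_square mult.commute)
  qed (use assms in \<open>simp add: mcp_def s_def\<close>)
  moreover have "mcp l1 a u = quad_poly (- 1 / (2 * a), l1, 0) u" if "u \<le> s" for u
    using that by (simp add: mcp_def s_def quad_poly_def)
  moreover have "quad_slope (- 1 / (2 * a), l1, 0) s = 0"
    using assms by (simp add: s_def quad_slope_def)
  ultimately show ?thesis
    using s flat assms
    by (intro piecewise_quadratic_penalty_ridge[of s "2 * s" l2 "mcp l1 a" "(- 1 / (2 * a), l1, 0)"
          "(0, 0, a * l1\<^sup>2 / 2)" "(0, 0, a * l1\<^sup>2 / 2)"])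
      (auto simp: quad_slope_def[of "(0, _)"])
qed

text \<open>The slope of \<open>q\<close> drops from \<open>l1\<close> to 0 at \<open>a\<close>, a
  strictly concave junction; \<open>2 * a\<close> is a dummy junction inside the flat part.\<close>

lemma piecewise_quadratic_capped_l1:
  assumes "l1 > 0" "l2 \<ge> 0" "a > 0"
  shows "piecewise_quadratic_penalty (\<lambda>x. penalty (capped_l1 l1 a) l2 \<bar>x\<bar>)"
  by (rule piecewise_quadratic_penalty_ridge[of a "2 * a" l2 "capped_l1 l1 a"
        "(0, l1, 0)" "(0, 0, l1 * a)" "(0, 0, l1 * a)"])
    (use assms in \<open>auto simp: capped_l1_def quad_poly_def quad_slope_def\<close>)

section \<open>The parallel algorithm\<close>

lemma row_block_mult: "row_block I X *v b = row_block I (X *v (b :: real ^ 'p))"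
  by (simp add: vec_eq_iff row_block_def matrix_vector_mult_def)

lemma row_block_linear:
  fixes u v :: "real ^ 'n"
  shows "row_block I u + row_block I v = row_block I (u + v)"
    and "row_block I u - row_block I v = row_block I (u - v)"
    and "c *\<^sub>R row_block I u = row_block I (c *\<^sub>R u)"
  by (simp_all add: vec_eq_iff row_block_def)

lemma row_block_idem [simp]: "row_block I (row_block I z) = row_block I z"
  by (simp add: vec_eq_iff row_block_def)

lemma vec_loss_row_block: "L 0 = 0 \<Longrightarrow> vec_loss L (row_block I z) = (\<Sum>i\<in>I. L (z $ i))"
  by (simp add: vec_loss_def row_block_def if_distrib sum.If_cases)

lemma norm_row_block: "(norm (row_block I (z :: real ^ 'n)))\<^sup>2 = (\<Sum>i\<in>I. (z $ i)\<^sup>2)"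
  unfolding power2_norm_eq_inner inner_vec_def row_block_def
  by (simp add: power2_eq_square if_distrib sum.If_cases cong: if_cong)

lemma sum_row_partition:
  fixes \<phi> :: "'n::finite \<Rightarrow> real"
  assumes "row_partition M B"
  shows "(\<Sum>m=1..M. \<Sum>i\<in>B m. \<phi> i) = (\<Sum>i\<in>UNIV. \<phi> i)"
proof -
  have disj: "\<forall>i\<in>{1..M}. \<forall>j\<in>{1..M}. i \<noteq> j \<longrightarrow> B i \<inter> B j = {}"
    and cover: "(\<Union>m\<in>{1..M}. B m) = UNIV"
    using assms unfolding row_partition_def disjoint_family_on_def by auto
  show ?thesis
    using sum.UNION_disjoint[of "{1..M}" B \<phi>] disj cover by simp
qed

text \<open>Squared norm and loss both split as sums over the blocks. The
  \<open>\<beta>\<close>-objective is thus unchanged, and the \<open>r\<close>-objective is a sum of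
  independent block problems whose minimisers assemble to a global one.\<close>

lemma parallel_ladmm_imp_ladmm:
  fixes X :: "real ^ 'p ^ 'n"
  assumes part: "row_partition M B" and L0: "L 0 = 0"
    and par: "parallel_ladmm M B X y L P \<mu> \<eta> \<beta> r d"
  shows "ladmm X y L P \<mu> \<eta> \<beta> r d"
proof -
  have norms: "(\<Sum>m=1..M. (norm (row_block (B m) z))\<^sup>2) = (norm z)\<^sup>2" for z :: "real ^ 'n"
  proof -
    have "(norm z)\<^sup>2 = (\<Sum>i\<in>UNIV. (z $ i)\<^sup>2)"
      unfolding power2_norm_eq_inner inner_vec_def by (simp add: power2_eq_square)
    then show ?thesis
      unfolding norm_row_block sum_row_partition[OF part] by simp
  qed
  have losses: "(\<Sum>m=1..M. vec_loss L (row_block (B m) z)) = vec_loss L z" for z :: "real ^ 'n"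
    by (simp only: vec_loss_row_block[of L, OF L0] sum_row_partition[OF part]) (simp add: vec_loss_def)
  show ?thesis
    unfolding ladmm_def
  proof (intro allI conjI)
    fix k
    note step = par[unfolded parallel_ladmm_def Let_def row_block_mult row_block_linear norms,
        rule_format, of k]
    show "is_arg_min (\<lambda>b. vec_penalty P b + \<mu> / 2 * (norm (X *v b + r k - y - (1 / \<mu>) *\<^sub>R d k))\<^sup>2
        + 1 / 2 * quad_form (prox_matrix X \<mu> \<eta>) (b - \<beta> k)) (\<lambda>_. True) (\<beta> (Suc k))"
      using step by blast
    let ?c = "\<lambda>z. X *v \<beta> (Suc k) + z - y - (1 / \<mu>) *\<^sub>R d k"
    let ?f = "\<lambda>z. vec_loss L z + \<mu> / 2 * (norm (?c z))\<^sup>2"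
    let ?fm = "\<lambda>m z. vec_loss L (row_block (B m) z) + \<mu> / 2 * (norm (row_block (B m) (?c z)))\<^sup>2"
    have total: "?f z = (\<Sum>m=1..M. ?fm m z)" for z
      by (simp only: sum.distrib losses norms flip: sum_distrib_left)
    have "?f (r (Suc k)) \<le> ?f z" for z
      unfolding total
    proof (rule sum_mono)
      fix m assume m: "m \<in> {1..M}"
      have min: "is_arg_min (\<lambda>z. vec_loss L z + \<mu> / 2 * (norm (row_block (B m) (X *v \<beta> (Suc k)) + z
            - row_block (B m) y - row_block (B m) ((1 / \<mu>) *\<^sub>R d k)))\<^sup>2)
          (\<lambda>z. row_block (B m) z = z) (row_block (B m) (r (Suc k)))"
        using step m by blast
      show "?fm m (r (Suc k)) \<le> ?fm m z"
        using min[unfolded is_arg_min_linorder, THEN conjunct2, rule_format, of "row_block (B m) z"]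
        by (simp add: row_block_linear)
    qed
    then show "is_arg_min ?f (\<lambda>_. True) (r (Suc k))"
      by (simp add: is_arg_min_linorder)
    show "d (Suc k) = d k - \<mu> *\<^sub>R (X *v \<beta> (Suc k) + r (Suc k) - y)"
    proof (subst vec_eq_iff, rule allI)
      fix i
      obtain m where m: "m \<in> {1..M}" "i \<in> B m"
        using part unfolding row_partition_def by blast
      have "row_block (B m) (d (Suc k))
          = row_block (B m) (d k - \<mu> *\<^sub>R (X *v \<beta> (Suc k) + r (Suc k) - y))"
        using step m(1) by blast
      then have "row_block (B m) (d (Suc k)) $ i
          = row_block (B m) (d k - \<mu> *\<^sub>R (X *v \<beta> (Suc k) + r (Suc k) - y)) $ i"
        by simp
      then show "d (Suc k) $ i = (d k - \<mu> *\<^sub>R (X *v \<beta> (Suc k) + r (Suc k) - y)) $ i"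
        using m(2) by (simp only: row_block_def vec_lambda_beta if_True)
    qed
  qed
qed

section \<open>Error bound for the objective\<close>

definition vec_slope :: "(real \<Rightarrow> real) \<Rightarrow> real ^ 'n \<Rightarrow> real ^ 'n" where
  "vec_slope L' r = (\<chi> i. L' (r $ i))"

lemma mono_derivative_above_tangent:
  fixes f :: "real \<Rightarrow> real"
  assumes "\<And>u. (f has_real_derivative f' u) (at u)" "mono f'"
  shows "f u + f' u * (v - u) \<le> f v"
proof -
  have "convex_on UNIV f"
    by (rule convex_on_realI[of _ _ f']) (use assms in \<open>auto dest: monoD\<close>)
  then have "f' u * (v - u) \<le> f v - f u"
    by (rule convex_on_imp_above_tangent) (use assms in auto)
  then show ?thesis
    by simp
qed

context
  fixes l :: real and L L' :: "real \<Rightarrow> real"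
  assumes loss: "smooth_piecewise_quadratic l L L'"
begin

lemma vec_loss_ge_tangent: "vec_loss L r + vec_slope L' r \<bullet> (z - r) \<le> vec_loss L z"
proof -
  have "L (r $ i) + L' (r $ i) * (z $ i - r $ i) \<le> L (z $ i)" for i
    using loss unfolding smooth_piecewise_quadratic_def
    by (intro mono_derivative_above_tangent) auto
  then show ?thesis
    by (simp add: vec_loss_def vec_slope_def inner_vec_def sum_mono flip: sum.distrib)
qed

lemma vec_loss_le_quadratic:
  "vec_loss L z \<le> vec_loss L r + vec_slope L' r \<bullet> (z - r) + l / 2 * (norm (z - r))\<^sup>2"
proof -
  \<comment> \<open>Tangent inequality for the convex function
    \<open>l / 2 * u\<^sup>2 - L u\<close>; rearranged, it is the descent lemma.\<close>
  have *: "l / 2 * u\<^sup>2 - L u + (l * u - L' u) * (v - u) \<le> l / 2 * v\<^sup>2 - L v" for u v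
    by (rule mono_derivative_above_tangent)
      (use loss in \<open>auto simp: smooth_piecewise_quadratic_def intro!: derivative_eq_intros\<close>)
  have "L v \<le> L u + L' u * (v - u) + l / 2 * (v - u)\<^sup>2" for u v
    using *[of u v] by (simp add: algebra_simps power2_eq_square add_divide_distrib)
  then have "vec_loss L z \<le> (\<Sum>i\<in>UNIV. L (r $ i) + L' (r $ i) * (z $ i - r $ i) + l / 2 * (z $ i - r $ i)\<^sup>2)"
    unfolding vec_loss_def by (rule sum_mono)
  also have "\<dots> = vec_loss L r + vec_slope L' r \<bullet> (z - r) + l / 2 * (norm (z - r))\<^sup>2"
    unfolding power2_norm_eq_inner
    by (simp add: vec_loss_def vec_slope_def inner_vec_def sum.distrib sum_distrib_left power2_eq_square)
  finally show ?thesis .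
qed

lemma vec_slope_lipschitz:
  assumes "0 \<le> l"
  shows "norm (vec_slope L' z - vec_slope L' r) \<le> l * norm (z - r)"
proof -
  have *: "0 \<le> L' v - L' u \<and> L' v - L' u \<le> l * (v - u)" if "u \<le> v" for u v
  proof -
    have "L' u \<le> L' v" "l * u - L' u \<le> l * v - L' v"
      using loss that unfolding smooth_piecewise_quadratic_def by (blast dest: monoD)+
    then show ?thesis
      by (simp add: algebra_simps)
  qed
  have lip: "\<bar>L' v - L' u\<bar> \<le> l * \<bar>v - u\<bar>" for u v
    using *[of u v] *[of v u] by (cases "u \<le> v") auto
  have "norm (vec_slope L' z - vec_slope L' r) \<le> norm (l *\<^sub>R (z - r))"
    by (rule norm_le_componentwise_cart) (use lip assms in \<open>simp add: vec_slope_def abs_mult\<close>)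
  then show ?thesis
    using assms by simp
qed

lemma gderiv_vec_loss: "GDERIV (vec_loss L) r :> vec_slope L' r"
proof -
  have "((\<lambda>r. L (r $ i)) has_derivative (\<lambda>h. L' (r $ i) * h $ i)) (at r)" for i
  proof -
    have "(L has_derivative (\<lambda>h. L' (r $ i) * h)) (at (r $ i))"
      using loss by (simp add: smooth_piecewise_quadratic_def has_field_derivative_def)
    from has_derivative_compose[OF bounded_linear.has_derivative[OF bounded_linear_vec_nth has_derivative_ident] this]
    show ?thesis
      by simp
  qed
  then have "((\<lambda>r. \<Sum>i\<in>UNIV. L (r $ i)) has_derivative (\<lambda>h. \<Sum>i\<in>UNIV. L' (r $ i) * h $ i)) (at r)"
    by (intro has_derivative_sum)
  then show ?thesis
    by (simp add: gderiv_def vec_loss_def[abs_def] inner_vec_def vec_slope_def mult.commute)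
qed

lemma vec_loss_nonneg: "0 \<le> vec_loss L r"
  using loss by (auto simp: vec_loss_def smooth_piecewise_quadratic_def intro: sum_nonneg)

end

section \<open>Error bound on a single piece, and over all pieces\<close>

definition diag_mult :: "('a \<Rightarrow> real) \<Rightarrow> real ^ 'a \<Rightarrow> real ^ 'a" where
  "diag_mult a z = (\<chi> i. a i * z $ i)"

lemma linear_diag_mult: "linear (diag_mult a)"
  by (rule linearI) (simp_all add: diag_mult_def vec_eq_iff algebra_simps)

lemma inner_diag_mult: "u \<bullet> diag_mult a v = diag_mult a u \<bullet> v"
  by (simp add: diag_mult_def inner_vec_def algebra_simps)

text \<open>\<open>A\<close>, \<open>B\<close>, \<open>C\<close> are the coefficients of the loss
  pieces, \<open>D\<close>, \<open>F\<close>, \<open>K\<close> those of the penalty pieces, and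
  \<open>s\<close> marks the free coordinates. With \<open>w\<close> a penalty slope and
  \<open>G\<close> the loss gradient at \<open>y - X *v x\<close>, the vector
  \<open>w - transpose X *v G\<close> is the stationarity residual. The constants are chosen before
  \<open>x\<close>, so they depend on the piece only.\<close>

lemma quadratic_piece_error_bound:
  fixes X :: "real ^ 'p ^ 'n" and y B C :: "real ^ 'n" and F K :: "real ^ 'p"
  fixes A :: "'n \<Rightarrow> real" and D s :: "'p \<Rightarrow> real"
  assumes s: "\<And>j. s j \<in> {0, 1}"
  shows "\<exists>c v. \<exists>e>0. \<forall>x w G g.
    (\<forall>j. s j * x $ j = x $ j \<and> s j * w $ j = s j * (2 * D j * x $ j + F $ j)) \<and>
    (\<forall>i. G $ i = 2 * A i * (y - X *v x) $ i + B $ i) \<and>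
    g = (\<Sum>i\<in>UNIV. A i * ((y - X *v x) $ i)\<^sup>2 + B $ i * (y - X *v x) $ i + C $ i)
      + (\<Sum>j\<in>UNIV. D j * (x $ j)\<^sup>2 + F $ j * x $ j + K $ j) \<and>
    norm (w - transpose X *v G) < e \<longrightarrow>
    \<bar>g - v\<bar> \<le> c * (norm (w - transpose X *v G))\<^sup>2"
proof -
  define \<pi> where "\<pi> = diag_mult s"
  define A2 where "A2 = diag_mult (\<lambda>i. 2 * A i)"
  define D2 where "D2 = diag_mult (\<lambda>j. 2 * D j)"
  \<comment> \<open>Hessian compressed to the free coordinates by the projection
    \<open>\<pi>\<close>; \<open>b\<close> is the projected gradient at 0 and \<open>K0\<close> the
    constant term.\<close>
  define M where "M x = \<pi> (transpose X *v A2 (X *v \<pi> x) + D2 (\<pi> x))" for x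
  define b where "b = \<pi> (F - transpose X *v (A2 y + B))"
  define K0 where "K0 = (\<Sum>i\<in>UNIV. A i * (y $ i)\<^sup>2 + B $ i * y $ i + C $ i) + (\<Sum>j\<in>UNIV. K $ j)"
  have lin: "linear \<pi>" "linear A2" "linear D2"
    by (simp_all add: \<pi>_def A2_def D2_def linear_diag_mult)
  have self: "u \<bullet> \<pi> z = \<pi> u \<bullet> z" "u \<bullet> D2 z = D2 u \<bullet> z" for u z
    by (simp_all add: \<pi>_def D2_def inner_diag_mult)
  have selfA: "u \<bullet> A2 z = A2 u \<bullet> z" for u z
    by (simp add: A2_def inner_diag_mult)
  have "linear M"
    unfolding M_def
    by (rule linearI) (simp_all add: linear_add[OF lin(1)] linear_add[OF lin(2)] linear_add[OF lin(3)]
        linear_scale[OF lin(1)] linear_scale[OF lin(2)] linear_scale[OF lin(3)]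
        matrix_vector_right_distrib matrix_vector_mult_scaleR scaleR_add_right
        del: transpose_matrix_vector)
  moreover have Mform: "u \<bullet> M z = (X *v \<pi> u) \<bullet> A2 (X *v \<pi> z) + \<pi> u \<bullet> D2 (\<pi> z)" for u z
    unfolding M_def self(1) inner_add_right
    by (simp only: inner_commute[of "\<pi> u" "transpose X *v _"] inner_transpose_mult)
      (simp add: inner_commute)
  have "u \<bullet> M z = M u \<bullet> z" for u z
    unfolding Mform inner_commute[of "M u" z]
    using selfA[of "X *v \<pi> u"] self(2)[of "\<pi> u"] by (metis inner_commute)
  ultimately obtain c v e where e: "e > 0"
    and bound: "\<And>x. norm (M x + b) < e \<Longrightarrow> \<bar>b \<bullet> x + x \<bullet> M x / 2 - v\<bar> \<le> c * (norm (M x + b))\<^sup>2"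
    using quadratic_gradient_bound[of M b] by blast
  show ?thesis
  proof (rule exI[of _ "\<bar>c\<bar>"], rule exI[of _ "v + K0"], rule exI[of _ e],
      intro conjI allI impI, rule e, elim conjE)
    fix x w :: "real ^ 'p" and G :: "real ^ 'n" and g :: real
    assume xw: "\<forall>j. s j * x $ j = x $ j \<and> s j * w $ j = s j * (2 * D j * x $ j + F $ j)"
      and G: "\<forall>i. G $ i = 2 * A i * (y - X *v x) $ i + B $ i"
      and g: "g = (\<Sum>i\<in>UNIV. A i * ((y - X *v x) $ i)\<^sup>2 + B $ i * (y - X *v x) $ i + C $ i)
        + (\<Sum>j\<in>UNIV. D j * (x $ j)\<^sup>2 + F $ j * x $ j + K $ j)"
      and small: "norm (w - transpose X *v G) < e"
    have \<pi>x: "\<pi> x = x" and \<pi>w: "\<pi> w = \<pi> (D2 x + F)"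
      using xw by (simp_all add: \<pi>_def D2_def diag_mult_def vec_eq_iff)
    have G_eq: "G = A2 y - A2 (X *v x) + B"
      using G by (simp add: A2_def diag_mult_def vec_eq_iff algebra_simps)
    have "M x + b = \<pi> (D2 x + F) - \<pi> (transpose X *v G)"
      unfolding M_def b_def \<pi>x G_eq linear_add[OF lin(1), symmetric] linear_diff[OF lin(1), symmetric]
      by (rule arg_cong[of _ _ \<pi>])
        (simp add: matrix_vector_right_distrib matrix_vector_mult_diff_distrib del: transpose_matrix_vector)
    then have grad: "M x + b = \<pi> (w - transpose X *v G)"
      by (simp add: linear_diff[OF lin(1)] \<pi>w)
    \<comment> \<open>Only the free components of the residual form the reduced gradient; projecting
      cannot lengthen it.\<close>
    have "\<bar>s j\<bar> \<le> 1" for j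
      using s[of j] by auto
    then have "norm (\<pi> z) \<le> norm z" for z
      by (intro norm_le_componentwise_cart)
        (simp add: \<pi>_def diag_mult_def abs_mult mult_left_le_one_le)
    then have le: "norm (M x + b) \<le> norm (w - transpose X *v G)"
      by (simp only: grad)
    have "b \<bullet> x = F \<bullet> x - (A2 y + B) \<bullet> (X *v x)"
      unfolding b_def self(1)[symmetric] \<pi>x inner_diff_left inner_transpose_mult ..
    then have "b \<bullet> x + x \<bullet> M x / 2 + K0 = F \<bullet> x - (A2 y + B) \<bullet> (X *v x)
        + ((X *v x) \<bullet> A2 (X *v x) + x \<bullet> D2 x) / 2 + K0"
      by (simp only: Mform \<pi>x)
    also have "\<dots> = g"
    proof -
      have "(\<Sum>i\<in>UNIV. A i * ((y - X *v x) $ i)\<^sup>2 + B $ i * (y - X *v x) $ i + C $ i)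
          = (X *v x) \<bullet> A2 (X *v x) / 2 - (A2 y + B) \<bullet> (X *v x)
            + (\<Sum>i\<in>UNIV. A i * (y $ i)\<^sup>2 + B $ i * y $ i + C $ i)"
        unfolding inner_vec_def A2_def diag_mult_def sum_divide_distrib
          sum_subtractf[symmetric] sum.distrib[symmetric]
        by (rule sum.cong) (simp_all add: algebra_simps power2_eq_square)
      moreover have "(\<Sum>j\<in>UNIV. D j * (x $ j)\<^sup>2 + F $ j * x $ j + K $ j)
          = x \<bullet> D2 x / 2 + F \<bullet> x + (\<Sum>j\<in>UNIV. K $ j)"
        unfolding inner_vec_def D2_def diag_mult_def sum_divide_distrib sum.distrib[symmetric]
        by (rule sum.cong) (simp_all add: algebra_simps power2_eq_square)
      ultimately show ?thesis
        by (simp add: g K0_def add_divide_distrib)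
    qed
    finally have "b \<bullet> x + x \<bullet> M x / 2 - v = g - (v + K0)"
      by simp
    then have "\<bar>g - (v + K0)\<bar> \<le> c * (norm (M x + b))\<^sup>2"
      using bound[of x] le small by simp
    also have "\<dots> \<le> \<bar>c\<bar> * (norm (w - transpose X *v G))\<^sup>2"
      using le by (intro mult_mono power_mono) auto
    finally show "\<bar>g - (v + K0)\<bar> \<le> \<bar>c\<bar> * (norm (w - transpose X *v G))\<^sup>2" .
  qed
qed

lemma vec_penalty_axis:
  "vec_penalty P (x + t *\<^sub>R axis j 1) = vec_penalty P x - P \<bar>x $ j\<bar> + P \<bar>x $ j + t\<bar>"
proof -
  have "vec_penalty P (x + t *\<^sub>R axis j 1) = P \<bar>x $ j + t\<bar> + (\<Sum>i\<in>UNIV - {j}. P \<bar>x $ i\<bar>)"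
    unfolding vec_penalty_def by (subst sum.remove[of _ j]) (auto intro: sum.cong simp: axis_def)
  moreover have "vec_penalty P x = P \<bar>x $ j\<bar> + (\<Sum>i\<in>UNIV - {j}. P \<bar>x $ i\<bar>)"
    unfolding vec_penalty_def by (subst sum.remove[of _ j]) auto
  ultimately show ?thesis
    by simp
qed

text \<open>A piece of the objective is a choice of one scalar piece per row for the loss and per
  coordinate for the penalty. The proximal inequality, tested along the coordinate axes, yields the
  scalar inequality that selects a penalty piece.\<close>

lemma piecewise_quadratic_error_bound:
  fixes X :: "real ^ 'p ^ 'n" and y :: "real ^ 'n" and x v :: "nat \<Rightarrow> real ^ 'p"
  assumes loss: "smooth_piecewise_quadratic l L L'"
    and pen: "piecewise_quadratic_penalty (\<lambda>x. P \<bar>x\<bar>)"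
    and prox: "\<And>k b. vec_penalty P (x k) + v k \<bullet> (b - x k) - \<eta> / 2 * (norm (b - x k))\<^sup>2 \<le> vec_penalty P b"
    and w: "w = (\<lambda>k. norm (v k - transpose X *v vec_slope L' (y - X *v x k)))" "w \<longlonglongrightarrow> 0"
    and g: "g = (\<lambda>k. vec_loss L (y - X *v x k) + vec_penalty P (x k))" "g \<longlonglongrightarrow> G"
  shows "\<exists>C. \<forall>\<^sub>F k in sequentially. \<bar>g k - G\<bar> \<le> C * (w k)\<^sup>2"
proof -
  obtain T where T: "finite T" "\<And>u. \<exists>p\<in>T. L u = quad_poly p u \<and> L' u = quad_slope p u"
    using loss unfolding smooth_piecewise_quadratic_def by blast
  obtain S where S: "S \<subseteq> {0, 1} \<times> UNIV" "finite S"
    and Sx: "\<And>x v \<eta>. (\<forall>t. P \<bar>x\<bar> + v * t - \<eta> / 2 * t\<^sup>2 \<le> P \<bar>x + t\<bar>) \<Longrightarrow>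
      \<exists>(s, p)\<in>S. s * x = x \<and> P \<bar>x\<bar> = quad_poly p x \<and> s * v = s * quad_slope p x"
    using pen unfolding piecewise_quadratic_penalty_def by blast
  \<comment> \<open>\<open>R\<close> is the finite set of choices, and \<open>Q f k\<close> says
    that iterate \<open>k\<close> agrees with choice \<open>f\<close> in value and slope.\<close>
  define R :: "(('n \<Rightarrow> _) \<times> ('p \<Rightarrow> _)) set" where "R = (UNIV \<rightarrow>\<^sub>E T) \<times> (UNIV \<rightarrow>\<^sub>E S)"
  define Q where "Q f k \<longleftrightarrow>
    (\<forall>i. let u = (y - X *v x k) $ i in
       L u = quad_poly (fst f i) u \<and> L' u = quad_slope (fst f i) u) \<and>
    (\<forall>j. let s = fst (snd f j); p = snd (snd f j); u = x k $ j in
       s * u = u \<and> P \<bar>u\<bar> = quad_poly p u \<and> s * v k $ j = s * quad_slope p u)"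
    for f :: "('n \<Rightarrow> real \<times> real \<times> real) \<times> ('p \<Rightarrow> real \<times> real \<times> real \<times> real)" and k
  show ?thesis
  proof (rule finite_pieces_error_bound[OF _ _ _ w(2) g(2), of R Q])
    show "finite R"
      unfolding R_def using T(1) S(2) by (intro finite_cartesian_product finite_PiE) auto
    show "\<exists>f\<in>R. Q f k" for k
    proof -
      obtain f where f: "\<And>i. f i \<in> T \<and> L ((y - X *v x k) $ i) = quad_poly (f i) ((y - X *v x k) $ i)
          \<and> L' ((y - X *v x k) $ i) = quad_slope (f i) ((y - X *v x k) $ i)"
        using bchoice[of UNIV "\<lambda>i p. p \<in> T \<and> L ((y - X *v x k) $ i) = quad_poly p ((y - X *v x k) $ i)
          \<and> L' ((y - X *v x k) $ i) = quad_slope p ((y - X *v x k) $ i)"] T(2) by blast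
      have "\<exists>h\<in>S. fst h * x k $ j = x k $ j \<and> P \<bar>x k $ j\<bar> = quad_poly (snd h) (x k $ j)
          \<and> fst h * v k $ j = fst h * quad_slope (snd h) (x k $ j)" for j
      proof -
        have "P \<bar>x k $ j\<bar> + v k $ j * t - \<eta> / 2 * t\<^sup>2 \<le> P \<bar>x k $ j + t\<bar>" for t
          using prox[of k "x k + t *\<^sub>R axis j 1"]
          by (simp add: vec_penalty_axis inner_axis power_mult_distrib mult.commute)
        then have "\<exists>(s, p)\<in>S. s * x k $ j = x k $ j \<and> P \<bar>x k $ j\<bar> = quad_poly p (x k $ j)
            \<and> s * v k $ j = s * quad_slope p (x k $ j)"
          by (intro Sx[of _ _ \<eta>] allI)
        then show ?thesis
          by (simp add: split_beta)
      qed
      then obtain h where h: "\<And>j. h j \<in> S \<and> fst (h j) * x k $ j = x k $ j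
          \<and> P \<bar>x k $ j\<bar> = quad_poly (snd (h j)) (x k $ j)
          \<and> fst (h j) * v k $ j = fst (h j) * quad_slope (snd (h j)) (x k $ j)"
        by metis
      have "(f, h) \<in> R" "Q (f, h) k"
        using f h by (auto simp: R_def Q_def Let_def)
      then show ?thesis
        by blast
    qed
    fix f assume f: "f \<in> R"
    define A where "A i = fst (fst f i)" for i
    define B where "B = (\<chi> i. fst (snd (fst f i)))"
    define C where "C = (\<chi> i. snd (snd (fst f i)))"
    define s where "s j = fst (snd f j)" for j
    define D where "D j = fst (snd (snd f j))" for j
    define F where "F = (\<chi> j. fst (snd (snd (snd f j))))"
    define K where "K = (\<chi> j. snd (snd (snd (snd f j))))"
    have s01: "s j \<in> {0, 1}" for j
      using f S(1) unfolding R_def s_def by (cases f) (auto dest!: PiE_mem[of _ UNIV "\<lambda>_. S" j])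
    obtain c u e where e: "e > 0" and bound: "\<And>x w G g.
      (\<forall>j. s j * x $ j = x $ j \<and> s j * w $ j = s j * (2 * D j * x $ j + F $ j)) \<and>
      (\<forall>i. G $ i = 2 * A i * (y - X *v x) $ i + B $ i) \<and>
      g = (\<Sum>i\<in>UNIV. A i * ((y - X *v x) $ i)\<^sup>2 + B $ i * (y - X *v x) $ i + C $ i)
        + (\<Sum>j\<in>UNIV. D j * (x $ j)\<^sup>2 + F $ j * x $ j + K $ j) \<and>
      norm (w - transpose X *v G) < e \<Longrightarrow>
      \<bar>g - u\<bar> \<le> c * (norm (w - transpose X *v G))\<^sup>2"
      using quadratic_piece_error_bound[where s = s, OF s01, where A = A and B = B and C = C and D = D and F = F
          and K = K and X = X and y = y] by blast
    have "\<bar>g k - u\<bar> \<le> c * (w k)\<^sup>2" if Q: "Q f k" and small: "w k < e" for k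
      unfolding w(1)
    proof (rule bound, intro conjI)
      show "\<forall>j. s j * x k $ j = x k $ j \<and> s j * v k $ j = s j * (2 * D j * x k $ j + F $ j)"
        using Q by (simp add: Q_def Let_def s_def D_def F_def quad_slope_def split_beta)
      show "\<forall>i. vec_slope L' (y - X *v x k) $ i = 2 * A i * (y - X *v x k) $ i + B $ i"
        using Q by (simp add: Q_def Let_def A_def B_def quad_slope_def split_beta vec_slope_def)
      show "g k = (\<Sum>i\<in>UNIV. A i * ((y - X *v x k) $ i)\<^sup>2 + B $ i * (y - X *v x k) $ i + C $ i)
        + (\<Sum>j\<in>UNIV. D j * (x k $ j)\<^sup>2 + F $ j * x k $ j + K $ j)"
        using Q by (simp add: g(1) Q_def Let_def A_def B_def C_def D_def F_def K_def quad_poly_def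
            split_beta vec_loss_def vec_penalty_def)
      show "norm (v k - transpose X *v vec_slope L' (y - X *v x k)) < e"
        using small by (simp add: w(1))
    qed
    then show "\<exists>c u. \<exists>e>0. \<forall>k. Q f k \<and> w k < e \<longrightarrow> \<bar>g k - u\<bar> \<le> c * (w k)\<^sup>2"
      using e by blast
  qed
qed

text \<open>The difference quotient is at least \<open>- \<eta> / 2 * norm (z - x)\<close>, which
  tends to 0.\<close>

lemma proximal_imp_regular_subdiff:
  fixes f :: "'a::euclidean_space \<Rightarrow> real"
  assumes "\<And>z. f x + v \<bullet> (z - x) - \<eta> / 2 * (norm (z - x))\<^sup>2 \<le> f z"
  shows "v \<in> regular_subdiff f x"
proof -
  have "((\<lambda>z. - (\<eta> / 2 * norm (z - x))) \<longlongrightarrow> 0) (at x)"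
    by (auto intro!: tendsto_eq_intros)
  then have "Liminf (at x) (\<lambda>z. ereal (- (\<eta> / 2 * norm (z - x)))) = 0"
    unfolding zero_ereal_def by (intro lim_imp_Liminf tendsto_ereal) auto
  moreover have "Liminf (at x) (\<lambda>z. ereal (- (\<eta> / 2 * norm (z - x))))
      \<le> Liminf (at x) (\<lambda>z. ereal ((f z - f x - v \<bullet> (z - x)) / norm (z - x)))"
  proof (rule Liminf_mono, rule eventually_at_filter[THEN iffD2], rule always_eventually, intro allI impI)
    fix z assume z: "z \<noteq> x"
    have "- (\<eta> / 2 * (norm (z - x))\<^sup>2) \<le> f z - f x - v \<bullet> (z - x)"
      using assms[of z] by linarith
    then show "ereal (- (\<eta> / 2 * norm (z - x))) \<le> ereal ((f z - f x - v \<bullet> (z - x)) / norm (z - x))"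
      using z by (simp add: field_simps power2_eq_square)
  qed
  ultimately show ?thesis
    by (simp add: regular_subdiff_def)
qed

section \<open>Convergence of the iterates\<close>

lemma quad_form_prox_matrix:
  "quad_form (prox_matrix X \<mu> \<eta>) u = \<eta> * (norm u)\<^sup>2 - \<mu> * (norm (X *v u))\<^sup>2"
proof -
  have "prox_matrix X \<mu> \<eta> *v u = \<eta> *\<^sub>R u - \<mu> *\<^sub>R (transpose X *v (X *v u))"
    unfolding prox_matrix_def
    by (simp only: matrix_vector_mult_diff_rdistrib scaleR_matrix_vector_assoc[symmetric]
        matrix_vector_mul_lid matrix_vector_mul_assoc)
  moreover have "u \<bullet> (transpose X *v (X *v u)) = (norm (X *v u))\<^sup>2"
    unfolding inner_commute[of u] inner_transpose_mult power2_norm_eq_inner ..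
  ultimately show ?thesis
    by (simp add: quad_form_def inner_diff_right power2_norm_eq_inner del: transpose_matrix_vector)
qed

text \<open>Here \<open>l\<close> is the Lipschitz constant of \<open>L'\<close>, and
  \<open>coercive\<close> says that the proximal matrix dominates \<open>\<sigma>\<close> times the
  identity.\<close>

locale ladmm_iteration =
  fixes X :: "real ^ 'p ^ 'n" and y :: "real ^ 'n" and L L' P :: "real \<Rightarrow> real"
    and l \<mu> \<eta> \<sigma> :: real
    and \<beta> :: "nat \<Rightarrow> real ^ 'p" and r d :: "nat \<Rightarrow> real ^ 'n"
  assumes loss: "smooth_piecewise_quadratic l L L'"
    and pen: "piecewise_quadratic_penalty (\<lambda>x. P \<bar>x\<bar>)"
    and l: "0 \<le> l" and \<mu>: "0 < \<mu>" "2 * l\<^sup>2 < \<mu>\<^sup>2" and \<sigma>: "0 < \<sigma>" and \<eta>: "0 < \<eta>"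
    and coercive: "\<And>b. \<mu> * (norm (X *v b))\<^sup>2 + \<sigma> * (norm b)\<^sup>2 \<le> \<eta> * (norm b)\<^sup>2"
    and run: "ladmm X y L P \<mu> \<eta> \<beta> r d"
begin

definition residual :: "nat \<Rightarrow> real ^ 'n" where
  "residual k = X *v \<beta> k + r k - y"

text \<open>The penalty slope read off from the optimality condition of the
  \<open>\<beta>\<close>-subproblem. Index \<open>k\<close> belongs to the point
  \<open>\<beta> (Suc k)\<close>.\<close>

definition prox_slope :: "nat \<Rightarrow> real ^ 'p" where
  "prox_slope k = transpose X *v (d k - \<mu> *\<^sub>R residual k) - \<eta> *\<^sub>R (\<beta> (Suc k) - \<beta> k)"

definition lagrangian :: "nat \<Rightarrow> real" where
  "lagrangian k = vec_loss L (r k) + vec_penalty P (\<beta> k) - d k \<bullet> residual k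
     + \<mu> / 2 * (norm (residual k))\<^sup>2"

definition gap :: "nat \<Rightarrow> real" where
  "gap k = (norm (\<beta> (Suc k) - \<beta> k))\<^sup>2 + (norm (r (Suc k) - r k))\<^sup>2"

text \<open>Decrease of the Lagrangian per unit of \<open>gap\<close>: \<open>\<sigma> / 2\<close>
  from the \<open>\<beta>\<close>-step, and \<open>\<mu> / 2\<close> from the \<open>r\<close>-step
  less the dual loss \<open>l\<^sup>2 / \<mu>\<close>.\<close>

definition rate :: real where
  "rate = min (\<sigma> / 2) (\<mu> / 2 - l\<^sup>2 / \<mu>)"

definition objective :: "nat \<Rightarrow> real" where
  "objective k = vec_loss L (y - X *v \<beta> k) + vec_penalty P (\<beta> k)"

lemma rate_pos: "0 < rate"
  using \<mu> \<sigma> by (simp add: rate_def field_simps power2_eq_square)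

lemma l_less_\<mu>: "l < \<mu>"
proof (rule power2_less_imp_less)
  show "l\<^sup>2 < \<mu>\<^sup>2"
    using \<mu>(2) zero_le_power2[of l] by linarith
qed (use \<mu> in simp)

lemma dual_step: "d (Suc k) = d k - \<mu> *\<^sub>R residual (Suc k)"
  using run by (simp add: ladmm_def residual_def)

lemma beta_step:
  "vec_penalty P (\<beta> (Suc k))
     + \<mu> / 2 * (norm (X *v \<beta> (Suc k) + r k - y - (1 / \<mu>) *\<^sub>R d k))\<^sup>2
     + 1 / 2 * quad_form (prox_matrix X \<mu> \<eta>) (\<beta> (Suc k) - \<beta> k)
   \<le> vec_penalty P b + \<mu> / 2 * (norm (X *v b + r k - y - (1 / \<mu>) *\<^sub>R d k))\<^sup>2
     + 1 / 2 * quad_form (prox_matrix X \<mu> \<eta>) (b - \<beta> k)"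
  using run unfolding ladmm_def is_arg_min_linorder by blast

lemma r_step:
  "vec_loss L (r (Suc k))
     + \<mu> / 2 * (norm (X *v \<beta> (Suc k) + r (Suc k) - y - (1 / \<mu>) *\<^sub>R d k))\<^sup>2
   \<le> vec_loss L z + \<mu> / 2 * (norm (X *v \<beta> (Suc k) + z - y - (1 / \<mu>) *\<^sub>R d k))\<^sup>2"
  using run unfolding ladmm_def is_arg_min_linorder by blast

lemma prox_inequality:
  "vec_penalty P (\<beta> (Suc k)) + prox_slope k \<bullet> (b - \<beta> (Suc k)) - \<eta> / 2 * (norm (b - \<beta> (Suc k)))\<^sup>2
    \<le> vec_penalty P b"
proof -
  define q where "q = transpose X *v (d k - \<mu> *\<^sub>R residual k)"
  define c where "c = residual k - (1 / \<mu>) *\<^sub>R d k"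
  \<comment> \<open>The term \<open>- \<mu> / 2 * (norm (X *v (b - \<beta> k)))\<^sup>2\<close> from
    the proximal matrix cancels the quadratic part of the penalty on the constraint; only a linear
    term and \<open>\<eta> / 2\<close> times a squared distance remain.\<close>
  have eq: "\<mu> / 2 * (norm (X *v b + r k - y - (1 / \<mu>) *\<^sub>R d k))\<^sup>2
      + 1 / 2 * quad_form (prox_matrix X \<mu> \<eta>) (b - \<beta> k)
      = \<mu> / 2 * (norm c)\<^sup>2 - q \<bullet> (b - \<beta> k) + \<eta> / 2 * (norm (b - \<beta> k))\<^sup>2" for b
  proof -
    define z where "z = X *v (b - \<beta> k)"
    have "X *v b + r k - y - (1 / \<mu>) *\<^sub>R d k = c + z"
      by (simp add: c_def z_def residual_def matrix_vector_mult_diff_distrib)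
    moreover have "(norm (c + z))\<^sup>2 = (norm c)\<^sup>2 + 2 * (c \<bullet> z) + (norm z)\<^sup>2"
      by (simp add: power2_norm_eq_inner inner_add_left inner_add_right inner_commute)
    moreover have "q \<bullet> (b - \<beta> k) = - \<mu> * (c \<bullet> z)"
      unfolding q_def inner_transpose_mult z_def[symmetric] c_def
      using \<mu> by (simp add: inner_diff_left algebra_simps)
    ultimately show ?thesis
      by (simp add: quad_form_prox_matrix z_def[symmetric] field_simps)
  qed
  define u u' where "u = b - \<beta> k" and "u' = \<beta> (Suc k) - \<beta> k"
  have "vec_penalty P (\<beta> (Suc k)) - q \<bullet> u' + \<eta> / 2 * (norm u')\<^sup>2
      \<le> vec_penalty P b - q \<bullet> u + \<eta> / 2 * (norm u)\<^sup>2"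
    using beta_step[of k b] eq[of b] eq[of "\<beta> (Suc k)"] unfolding u_def u'_def by linarith
  moreover have norm_u: "(norm u)\<^sup>2 = (norm u')\<^sup>2 + 2 * (u' \<bullet> (u - u')) + (norm (u - u'))\<^sup>2"
    by (simp add: power2_norm_eq_inner inner_diff_left inner_diff_right inner_commute)
  have "\<eta> / 2 * (norm u)\<^sup>2 = \<eta> / 2 * (norm u')\<^sup>2 + \<eta> * (u' \<bullet> (u - u'))
      + \<eta> / 2 * (norm (u - u'))\<^sup>2"
    unfolding norm_u by (simp add: distrib_left)
  moreover have "prox_slope k = q - \<eta> *\<^sub>R u'"
    by (simp add: prox_slope_def q_def u'_def)
  then have "prox_slope k \<bullet> (u - u') = q \<bullet> u - q \<bullet> u' - \<eta> * (u' \<bullet> (u - u'))"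
    by (simp add: inner_diff_left inner_diff_right right_diff_distrib)
  moreover have diff: "b - \<beta> (Suc k) = u - u'"
    by (simp add: u_def u'_def)
  ultimately show ?thesis
    unfolding diff by linarith
qed

text \<open>Stationarity of the \<open>r\<close>-subproblem reads
  \<open>L'(r) + \<mu> * residual - d k = 0\<close> at the new point, and the dual update is exactly
  this solved for \<open>L'(r)\<close>. It holds only after an update, hence the shifted indices
  from here on.\<close>

lemma dual_eq_slope: "d (Suc k) = vec_slope L' (r (Suc k))"
proof -
  define c where "c = X *v \<beta> (Suc k) - y - (1 / \<mu>) *\<^sub>R d k"
  let ?f = "\<lambda>z. vec_loss L z + \<mu> / 2 * ((c + z) \<bullet> (c + z))"
  have eq: "X *v \<beta> (Suc k) + z - y - (1 / \<mu>) *\<^sub>R d k = c + z" for z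
    by (simp add: c_def)
  have min: "?f (r (Suc k)) \<le> ?f z" for z
    using r_step[of k z] unfolding eq by (simp only: power2_norm_eq_inner)
  have "(vec_loss L has_derivative (\<lambda>h. h \<bullet> vec_slope L' (r (Suc k)))) (at (r (Suc k)))"
    using gderiv_vec_loss[OF loss] by (simp add: gderiv_def)
  then have "(?f has_derivative (\<lambda>h. h \<bullet> vec_slope L' (r (Suc k))
      + \<mu> / 2 * ((c + r (Suc k)) \<bullet> h + h \<bullet> (c + r (Suc k))))) (at (r (Suc k)))"
    by (auto intro!: derivative_eq_intros)
  then have zero: "(\<lambda>h. h \<bullet> vec_slope L' (r (Suc k))
      + \<mu> / 2 * ((c + r (Suc k)) \<bullet> h + h \<bullet> (c + r (Suc k)))) = (\<lambda>h. 0)"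
    by (rule differential_zero_maxmin[of _ UNIV, rotated 2]) (use min in auto)
  have "h \<bullet> (vec_slope L' (r (Suc k)) + \<mu> *\<^sub>R (c + r (Suc k))) = 0" for h
    using fun_cong[OF zero, of h] by (simp add: inner_add_right inner_commute algebra_simps)
  then have "vec_slope L' (r (Suc k)) + \<mu> *\<^sub>R (c + r (Suc k)) = 0"
    by (metis inner_eq_zero_iff)
  moreover have "\<mu> *\<^sub>R (c + r (Suc k)) = \<mu> *\<^sub>R residual (Suc k) - d k"
    using \<mu> by (simp add: c_def residual_def algebra_simps)
  ultimately have "vec_slope L' (r (Suc k)) + (\<mu> *\<^sub>R residual (Suc k) - d k) = 0"
    by (simp only:)
  then show ?thesis
    unfolding dual_step by (metis add.commute diff_eq_eq eq_neg_iff_add_eq_0 minus_diff_eq)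
qed

lemma dual_increment_le: "norm (d (Suc (Suc k)) - d (Suc k)) \<le> l * norm (r (Suc (Suc k)) - r (Suc k))"
  unfolding dual_eq_slope by (rule vec_slope_lipschitz[OF loss l])

lemma residual_le: "norm (residual (Suc (Suc k))) \<le> l / \<mu> * norm (r (Suc (Suc k)) - r (Suc k))"
proof -
  have "\<mu> * norm (residual (Suc (Suc k))) = norm (d (Suc (Suc k)) - d (Suc k))"
    using dual_step[of "Suc k"] \<mu> by simp
  then show ?thesis
    using dual_increment_le[of k] \<mu> by (simp add: field_simps)
qed

text \<open>The proximal inequality bounds the \<open>\<beta>\<close>-step and convexity of the loss
  the \<open>r\<close>-step. The dual step adds \<open>\<mu> * (norm e')\<^sup>2\<close>, which
  \<open>residual_le\<close> pays for out of the gain of the \<open>r\<close>-step.\<close>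

lemma lagrangian_descent: "lagrangian (Suc (Suc k)) + rate * gap (Suc k) \<le> lagrangian (Suc k)"
proof -
  let ?k = "Suc k" and ?k' = "Suc (Suc k)"
  define u where "u = \<beta> ?k' - \<beta> ?k"
  define z where "z = X *v u"
  define s where "s = r ?k' - r ?k"
  define e where "e = residual ?k"
  define e' where "e' = residual ?k'"
  have e': "e' = e + z + s"
    by (simp add: e'_def e_def z_def u_def s_def residual_def matrix_vector_mult_diff_distrib)
  have "vec_penalty P (\<beta> ?k') + prox_slope ?k \<bullet> (- u) - \<eta> / 2 * (norm u)\<^sup>2 \<le> vec_penalty P (\<beta> ?k)"
    using prox_inequality[of ?k "\<beta> ?k"] by (simp add: u_def norm_minus_commute)
  moreover have "prox_slope ?k \<bullet> u = d ?k \<bullet> z - \<mu> * (e \<bullet> z) - \<eta> * (norm u)\<^sup>2"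
    unfolding prox_slope_def inner_diff_left inner_transpose_mult u_def[symmetric]
    by (simp add: z_def e_def inner_diff_left power2_norm_eq_inner)
  ultimately have 1: "vec_penalty P (\<beta> ?k') - d ?k \<bullet> z + \<mu> * (e \<bullet> z) + \<eta> / 2 * (norm u)\<^sup>2
      \<le> vec_penalty P (\<beta> ?k)"
    by simp
  have 2: "\<mu> * (norm z)\<^sup>2 + \<sigma> * (norm u)\<^sup>2 \<le> \<eta> * (norm u)\<^sup>2"
    unfolding z_def by (rule coercive)
  have "vec_loss L (r ?k') + d ?k' \<bullet> (- s) \<le> vec_loss L (r ?k)"
    using vec_loss_ge_tangent[OF loss, of "r ?k'" "r ?k"] by (simp add: dual_eq_slope s_def)
  then have 3: "vec_loss L (r ?k') - d ?k \<bullet> s + \<mu> * (e' \<bullet> s) \<le> vec_loss L (r ?k)"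
    unfolding dual_step[of ?k] e'_def by (simp add: inner_diff_left)
  have 4: "d ?k' \<bullet> e' = d ?k \<bullet> e + d ?k \<bullet> z + d ?k \<bullet> s - \<mu> * (norm e')\<^sup>2"
    unfolding dual_step[of ?k] by (simp add: e'_def[symmetric] inner_diff_left power2_norm_eq_inner)
      (simp add: e' inner_add_right)
  \<comment> \<open>Expansion of \<open>e = e' - z - s\<close>, arranged to contain just the
    products \<open>e' \<bullet> s\<close> and \<open>e \<bullet> z\<close> occurring in facts 1 and
    3, so that they cancel.\<close>
  have 5: "(norm e)\<^sup>2 = (norm e')\<^sup>2 - 2 * (e' \<bullet> s) - 2 * (e \<bullet> z) + (norm s)\<^sup>2 - (norm z)\<^sup>2"
    unfolding e' power2_norm_eq_inner
    by (simp add: inner_add_left inner_add_right inner_commute)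
  have "\<mu> * norm e' \<le> l * norm s"
    using residual_le[of k] \<mu> by (simp add: e'_def s_def field_simps)
  then have "(\<mu> * norm e')\<^sup>2 \<le> (l * norm s)\<^sup>2"
    using \<mu> by (intro power_mono) auto
  then have 6: "\<mu> * (norm e')\<^sup>2 \<le> l\<^sup>2 / \<mu> * (norm s)\<^sup>2"
    using \<mu> by (simp add: field_simps power2_eq_square)
  have "rate * (norm u)\<^sup>2 \<le> \<sigma> / 2 * (norm u)\<^sup>2" "rate * (norm s)\<^sup>2 \<le> (\<mu> / 2 - l\<^sup>2 / \<mu>) * (norm s)\<^sup>2"
    unfolding rate_def
    by (rule mult_right_mono[OF min.cobounded1], simp, rule mult_right_mono[OF min.cobounded2], simp)
  then have 7: "rate * gap ?k \<le> \<sigma> / 2 * (norm u)\<^sup>2 + \<mu> / 2 * (norm s)\<^sup>2 - l\<^sup>2 / \<mu> * (norm s)\<^sup>2"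
    by (simp add: gap_def u_def s_def algebra_simps)
  have 8: "\<mu> / 2 * (norm e)\<^sup>2 = \<mu> / 2 * (norm e')\<^sup>2 - \<mu> * (e' \<bullet> s) - \<mu> * (e \<bullet> z)
      + \<mu> / 2 * (norm s)\<^sup>2 - \<mu> / 2 * (norm z)\<^sup>2"
    unfolding 5 by (simp add: field_simps)
  show ?thesis
    unfolding lagrangian_def e_def[symmetric] e'_def[symmetric] using 1 2 3 4 6 7 8 by linarith
qed

text \<open>Eliminating \<open>r\<close> moves the loss argument from \<open>r\<close> to
  \<open>y - X *v \<beta>\<close>, a shift by minus the residual. As \<open>d\<close> is the loss
  gradient at \<open>r\<close>, convexity gives the first bound, and \<open>l\<close>-smoothness
  with \<open>l < \<mu>\<close> the second.\<close>

lemma objective_bounds: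
  "lagrangian (Suc k) - \<mu> / 2 * (norm (residual (Suc k)))\<^sup>2 \<le> objective (Suc k)"
  "objective (Suc k) \<le> lagrangian (Suc k)"
proof -
  have eq: "y - X *v \<beta> (Suc k) - r (Suc k) = - residual (Suc k)"
    by (simp add: residual_def)
  have "l / 2 * (norm (residual (Suc k)))\<^sup>2 \<le> \<mu> / 2 * (norm (residual (Suc k)))\<^sup>2"
    using l_less_\<mu> by (intro mult_right_mono) auto
  then show "objective (Suc k) \<le> lagrangian (Suc k)"
    using vec_loss_le_quadratic[OF loss, of "y - X *v \<beta> (Suc k)" "r (Suc k)"]
    by (simp add: objective_def lagrangian_def eq dual_eq_slope)
  show "lagrangian (Suc k) - \<mu> / 2 * (norm (residual (Suc k)))\<^sup>2 \<le> objective (Suc k)"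
    using vec_loss_ge_tangent[OF loss, of "r (Suc k)" "y - X *v \<beta> (Suc k)"]
    by (simp add: objective_def lagrangian_def eq dual_eq_slope)
qed

lemma objective_nonneg: "0 \<le> objective k"
  using vec_loss_nonneg[OF loss] pen
  by (auto simp: objective_def vec_penalty_def piecewise_quadratic_penalty_def intro!: add_nonneg_nonneg sum_nonneg)

text \<open>\<open>prox_slope\<close> is built from the old \<open>d\<close> and residual, the loss
  gradient from the new \<open>\<beta>\<close>; every mismatch is controlled by the length of the
  step.\<close>

lemma stationarity_gap:
  "\<exists>C\<ge>0. \<forall>k. norm (prox_slope (Suc k) - transpose X *v vec_slope L' (y - X *v \<beta> (Suc (Suc k))))
     \<le> C * sqrt (gap (Suc k))"
proof -
  obtain B where B: "B > 0" "\<And>z. norm (transpose X *v z) \<le> B * norm z"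
    using bounded_linear.pos_bounded[OF matrix_vector_mul_bounded_linear[of "transpose X"]]
    by (metis mult.commute)
  obtain A where A: "A > 0" "\<And>z. norm (X *v z) \<le> A * norm z"
    using bounded_linear.pos_bounded[OF matrix_vector_mul_bounded_linear[of X]] by (metis mult.commute)
  \<comment> \<open>Summands in order: dual against loss gradient, dual increment, the old residual
    times \<open>\<mu>\<close>, and the proximal term \<open>\<eta>\<close>; \<open>A\<close> and
    \<open>B\<close> bound the operators \<open>X\<close> and its transpose.\<close>
  define C where "C = B * (l * (l / \<mu>) + (l + \<mu> * (l / \<mu> + A + 1))) + \<eta>"
  have "norm (prox_slope (Suc k) - transpose X *v vec_slope L' (y - X *v \<beta> (Suc (Suc k))))
     \<le> C * sqrt (gap (Suc k))" for k
  proof -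
    let ?k = "Suc k" and ?k' = "Suc (Suc k)"
    define u where "u = \<beta> ?k' - \<beta> ?k"
    define s where "s = r ?k' - r ?k"
    define \<delta> where "\<delta> = sqrt (gap ?k)"
    define g where "g = vec_slope L' (y - X *v \<beta> ?k')"
    have us: "norm u \<le> \<delta>" "norm s \<le> \<delta>"
      by (auto simp: \<delta>_def gap_def u_def s_def intro!: real_le_rsqrt)
    have res: "norm (residual ?k') \<le> l / \<mu> * \<delta>"
      using residual_le[of k] mult_left_mono[OF us(2), of "l / \<mu>"] l \<mu> by (simp add: s_def)
    have "norm (d ?k' - g) \<le> l * norm (residual ?k')"
      using vec_slope_lipschitz[OF loss l, of "r ?k'" "y - X *v \<beta> ?k'"]
      by (simp add: dual_eq_slope g_def residual_def algebra_simps)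
    also have "\<dots> \<le> l * (l / \<mu> * \<delta>)"
      using res l by (rule mult_left_mono)
    finally have 1: "norm (d ?k' - g) \<le> l * (l / \<mu>) * \<delta>"
      by simp
    have 2: "norm (d ?k - d ?k') \<le> l * \<delta>"
      using dual_increment_le[of k] mult_left_mono[OF us(2), of l] l by (simp add: s_def norm_minus_commute)
    \<comment> \<open>\<open>residual_le\<close> starts at index 2, so the old residual is reached
      from the new one.\<close>
    have "residual ?k = residual ?k' - X *v u - s"
      by (simp add: residual_def u_def s_def matrix_vector_mult_diff_distrib)
    then have "norm (residual ?k) \<le> norm (residual ?k') + norm (X *v u) + norm s"
      using norm_triangle_ineq4[of "residual ?k' - X *v u" s] norm_triangle_ineq4[of "residual ?k'" "X *v u"]
      by simp
    also have "\<dots> \<le> l / \<mu> * \<delta> + A * \<delta> + \<delta>"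
      using res A(2)[of u] mult_left_mono[OF us(1), of A] A(1) us by linarith
    finally have "\<mu> * norm (residual ?k) \<le> \<mu> * (l / \<mu> * \<delta> + A * \<delta> + \<delta>)"
      using \<mu> by (intro mult_left_mono) auto
    then have 3: "norm (\<mu> *\<^sub>R residual ?k) \<le> \<mu> * (l / \<mu> + A + 1) * \<delta>"
      using \<mu> by (simp add: algebra_simps)
    define a where "a = (d ?k' - g) + (d ?k - d ?k') - \<mu> *\<^sub>R residual ?k"
    have "norm a \<le> norm (d ?k' - g) + norm (d ?k - d ?k') + norm (\<mu> *\<^sub>R residual ?k)"
      unfolding a_def by (meson add_right_mono norm_triangle_ineq norm_triangle_ineq4 order_trans)
    also have "\<dots> \<le> (l * (l / \<mu>) + (l + \<mu> * (l / \<mu> + A + 1))) * \<delta>"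
      unfolding distrib_right using 1 2 3 by linarith
    finally have "B * norm a \<le> B * ((l * (l / \<mu>) + (l + \<mu> * (l / \<mu> + A + 1))) * \<delta>)"
      using B(1) by (intro mult_left_mono) auto
    then have 4: "norm (transpose X *v a) \<le> B * (l * (l / \<mu>) + (l + \<mu> * (l / \<mu> + A + 1))) * \<delta>"
      using B(2)[of a] by (simp only: mult.assoc)
    have 5: "norm (\<eta> *\<^sub>R u) \<le> \<eta> * \<delta>"
      using us(1) \<eta> by simp
    have eq: "prox_slope ?k - transpose X *v g = transpose X *v a - \<eta> *\<^sub>R u"
      by (simp add: prox_slope_def a_def u_def matrix_vector_mult_diff_distrib
          matrix_vector_right_distrib algebra_simps del: transpose_matrix_vector)
    have "norm (prox_slope ?k - transpose X *v g)
        \<le> B * (l * (l / \<mu>) + (l + \<mu> * (l / \<mu> + A + 1))) * \<delta> + \<eta> * \<delta>"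
      unfolding eq by (rule order_trans[OF norm_triangle_ineq4 add_mono[OF 4 5]])
    then show ?thesis
      by (simp only: g_def \<delta>_def C_def distrib_right[of _ \<eta>])
  qed
  moreover have "0 \<le> C"
    using A(1) B(1) l \<mu> \<eta> by (simp add: C_def)
  ultimately show ?thesis
    by blast
qed

lemma gap_nonneg: "0 \<le> gap k"
  by (simp add: gap_def)

text \<open>Lagrangian and objective share the limit \<open>H\<close>, so the error bound at
  \<open>H\<close> bounds the Lagrangian's excess by a multiple of \<open>gap\<close>, which its own
  decrease controls.\<close>

lemma summable_sqrt_gap: "summable (\<lambda>k. sqrt (gap (Suc k)))"
proof -
  have lower: "0 \<le> lagrangian (Suc k)" for k
    using objective_bounds(2)[of k] objective_nonneg[of "Suc k"] by linarith
  have "lagrangian (Suc (Suc k)) \<le> lagrangian (Suc k)" for k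
    using lagrangian_descent[of k] rate_pos gap_nonneg[of "Suc k"] by (smt (verit) mult_nonneg_nonneg)
  then have "decseq (\<lambda>k. lagrangian (Suc k))"
    by (simp add: decseq_Suc_iff)
  then obtain H where H: "(\<lambda>k. lagrangian (Suc k)) \<longlonglongrightarrow> H" "\<And>k. H \<le> lagrangian (Suc k)"
    using decseq_convergent[of "\<lambda>k. lagrangian (Suc k)" 0] lower by metis
  have gap0: "(\<lambda>k. gap (Suc k)) \<longlonglongrightarrow> 0"
  proof (rule tendsto_sandwich[of "\<lambda>_. 0"])
    have "(\<lambda>k. (lagrangian (Suc k) - lagrangian (Suc (Suc k))) / rate) \<longlonglongrightarrow> (H - H) / rate"
      using H(1) LIMSEQ_Suc[OF H(1)] rate_pos by (intro tendsto_intros) auto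
    then show "(\<lambda>k. (lagrangian (Suc k) - lagrangian (Suc (Suc k))) / rate) \<longlonglongrightarrow> 0"
      by simp
    show "\<forall>\<^sub>F k in sequentially. gap (Suc k) \<le> (lagrangian (Suc k) - lagrangian (Suc (Suc k))) / rate"
    proof (rule always_eventually, rule allI)
      fix k show "gap (Suc k) \<le> (lagrangian (Suc k) - lagrangian (Suc (Suc k))) / rate"
        using lagrangian_descent[of k] rate_pos by (simp add: field_simps)
    qed
  qed (simp_all add: gap_nonneg)
  have resid: "(norm (residual (Suc (Suc k))))\<^sup>2 \<le> (l / \<mu>)\<^sup>2 * gap (Suc k)" for k
  proof -
    have "(norm (residual (Suc (Suc k))))\<^sup>2 \<le> (l / \<mu> * norm (r (Suc (Suc k)) - r (Suc k)))\<^sup>2"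
      using residual_le[of k] by (intro power_mono) auto
    also have "\<dots> \<le> (l / \<mu>)\<^sup>2 * gap (Suc k)"
      unfolding power_mult_distrib by (intro mult_left_mono) (auto simp: gap_def)
    finally show ?thesis .
  qed
  define w where "w k = norm (prox_slope (Suc k) - transpose X *v vec_slope L' (y - X *v \<beta> (Suc (Suc k))))" for k
  obtain C where C: "C \<ge> 0" "\<And>k. w k \<le> C * sqrt (gap (Suc k))"
    using stationarity_gap unfolding w_def by blast
  have w0: "w \<longlonglongrightarrow> 0"
  proof (rule tendsto_sandwich[of "\<lambda>_. 0" w _ "\<lambda>k. C * sqrt (gap (Suc k))"])
    have "(\<lambda>k. C * sqrt (gap (Suc k))) \<longlonglongrightarrow> C * sqrt 0"
      by (intro tendsto_intros gap0)
    then show "(\<lambda>k. C * sqrt (gap (Suc k))) \<longlonglongrightarrow> 0"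
      by simp
  qed (use C(2) in \<open>auto simp: w_def\<close>)
  have objective_lim: "(\<lambda>k. objective (Suc (Suc k))) \<longlonglongrightarrow> H"
  proof (rule tendsto_sandwich[of "\<lambda>k. lagrangian (Suc (Suc k)) - \<mu> / 2 * ((l / \<mu>)\<^sup>2 * gap (Suc k))"])
    have "(\<lambda>k. lagrangian (Suc (Suc k)) - \<mu> / 2 * ((l / \<mu>)\<^sup>2 * gap (Suc k)))
        \<longlonglongrightarrow> H - \<mu> / 2 * ((l / \<mu>)\<^sup>2 * 0)"
      by (intro tendsto_intros gap0 LIMSEQ_Suc[OF H(1)])
    then show "(\<lambda>k. lagrangian (Suc (Suc k)) - \<mu> / 2 * ((l / \<mu>)\<^sup>2 * gap (Suc k))) \<longlonglongrightarrow> H"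
      by simp
    show "(\<lambda>k. lagrangian (Suc (Suc k))) \<longlonglongrightarrow> H"
      by (rule LIMSEQ_Suc[OF H(1)])
    show "\<forall>\<^sub>F k in sequentially. lagrangian (Suc (Suc k)) - \<mu> / 2 * ((l / \<mu>)\<^sup>2 * gap (Suc k))
        \<le> objective (Suc (Suc k))"
    proof (rule always_eventually, rule allI)
      fix k
      have "\<mu> / 2 * (norm (residual (Suc (Suc k))))\<^sup>2 \<le> \<mu> / 2 * ((l / \<mu>)\<^sup>2 * gap (Suc k))"
        using \<mu> resid[of k] by (intro mult_left_mono) auto
      then show "lagrangian (Suc (Suc k)) - \<mu> / 2 * ((l / \<mu>)\<^sup>2 * gap (Suc k)) \<le> objective (Suc (Suc k))"
        using objective_bounds(1)[of "Suc k"] by linarith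
    qed
  qed (simp add: objective_bounds(2))
  obtain K where K: "\<forall>\<^sub>F k in sequentially. \<bar>objective (Suc (Suc k)) - H\<bar> \<le> K * (w k)\<^sup>2"
    using piecewise_quadratic_error_bound[OF loss pen, of "\<lambda>k. \<beta> (Suc (Suc k))" "\<lambda>k. prox_slope (Suc k)" \<eta>,
        OF prox_inequality _ w0 _ objective_lim] unfolding w_def objective_def by blast
  \<comment> \<open>The first part bounds the objective's excess over \<open>H\<close> via the
    residual \<open>w\<close>, the second the difference between Lagrangian and objective.\<close>
  define D where "D = \<bar>K\<bar> * C\<^sup>2 + \<mu> / 2 * (l / \<mu>)\<^sup>2"
  show ?thesis
  proof (rule sufficient_decrease_summable[of _ rate "\<lambda>k. lagrangian (Suc k) - H" D])
    show "\<forall>\<^sub>F k in sequentially. lagrangian (Suc (Suc k)) - H \<le> D * gap (Suc k)"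
      using K
    proof eventually_elim
      case (elim k)
      have "K * (w k)\<^sup>2 \<le> \<bar>K\<bar> * (C * sqrt (gap (Suc k)))\<^sup>2"
        using C(2)[of k] by (intro mult_mono power_mono) (auto simp: w_def)
      also have "\<dots> = \<bar>K\<bar> * C\<^sup>2 * gap (Suc k)"
        using gap_nonneg[of "Suc k"] by (simp add: power_mult_distrib)
      finally have "objective (Suc (Suc k)) - H \<le> \<bar>K\<bar> * C\<^sup>2 * gap (Suc k)"
        using elim by linarith
      moreover have "\<mu> / 2 * (norm (residual (Suc (Suc k))))\<^sup>2 \<le> \<mu> / 2 * ((l / \<mu>)\<^sup>2 * gap (Suc k))"
        using \<mu> resid[of k] by (intro mult_left_mono) auto
      ultimately show ?case
        using objective_bounds(1)[of "Suc k"] unfolding D_def distrib_right by linarith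
    qed
  qed (use lagrangian_descent H(2) rate_pos gap_nonneg in \<open>auto simp: algebra_simps\<close>)
qed

text \<open>Convergence of \<open>d\<close> comes from \<open>d = L'(r)\<close>. The slopes at
  \<open>\<beta> (Suc k)\<close> are regular subgradients converging to
  \<open>transpose X *v d'\<close>, and continuity of the penalty supplies the convergence of
  values.\<close>

lemma converges_to_critical_point:
  "\<exists>\<beta>' r' d'. \<beta> \<longlonglongrightarrow> \<beta>' \<and> r \<longlonglongrightarrow> r' \<and> d \<longlonglongrightarrow> d' \<and> critical_point X y L P \<beta>' r' d'"
proof -
  have "norm (\<beta> (Suc (Suc k)) - \<beta> (Suc k)) \<le> sqrt (gap (Suc k))"
    "norm (r (Suc (Suc k)) - r (Suc k)) \<le> sqrt (gap (Suc k))" for k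
    by (auto simp: gap_def intro!: real_le_rsqrt)
  then have "convergent (\<lambda>k. \<beta> (Suc k))" "convergent (\<lambda>k. r (Suc k))"
    by (auto intro: convergent_if_summable_increments[OF summable_sqrt_gap])
  then obtain \<beta>' r' where lim: "\<beta> \<longlonglongrightarrow> \<beta>'" "r \<longlonglongrightarrow> r'"
    unfolding convergent_def by (metis filterlim_sequentially_Suc)
  define d' where "d' = vec_slope L' r'"
  have "(\<lambda>k. d (Suc k)) \<longlonglongrightarrow> d'"
  proof (rule metric_tendsto_imp_tendsto[of "\<lambda>k. l *\<^sub>R r (Suc k)" "l *\<^sub>R r'"])
    show "(\<lambda>k. l *\<^sub>R r (Suc k)) \<longlonglongrightarrow> l *\<^sub>R r'"
      by (intro tendsto_intros LIMSEQ_Suc lim)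
    show "\<forall>\<^sub>F k in sequentially. dist (d (Suc k)) d' \<le> dist (l *\<^sub>R r (Suc k)) (l *\<^sub>R r')"
    proof (rule always_eventually, rule allI)
      fix k show "dist (d (Suc k)) d' \<le> dist (l *\<^sub>R r (Suc k)) (l *\<^sub>R r')"
        using vec_slope_lipschitz[OF loss l, of "r (Suc k)" r'] l
        by (simp add: dist_norm d'_def dual_eq_slope flip: scaleR_diff_right)
    qed
  qed
  then have d_lim: "d \<longlonglongrightarrow> d'"
    by (simp add: filterlim_sequentially_Suc)
  have X_lim: "(\<lambda>k. A *v z k) \<longlonglongrightarrow> A *v c" if "z \<longlonglongrightarrow> c" for A :: "real ^ 'c ^ 'd" and z c
    using bounded_linear.tendsto[OF matrix_vector_mul_bounded_linear that] .
  have res_lim: "residual \<longlonglongrightarrow> X *v \<beta>' + r' - y"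
    unfolding residual_def[abs_def] by (intro tendsto_intros X_lim lim)
  \<comment> \<open>The dual update shows the residual as a multiple of the dual increment, so
    convergence of \<open>d\<close> forces feasibility in the limit.\<close>
  have "residual (Suc k) = (1 / \<mu>) *\<^sub>R (d k - d (Suc k))" for k
    using \<mu> by (simp add: dual_step)
  moreover have "(\<lambda>k. (1 / \<mu>) *\<^sub>R (d k - d (Suc k))) \<longlonglongrightarrow> (1 / \<mu>) *\<^sub>R (d' - d')"
    by (intro tendsto_intros LIMSEQ_Suc d_lim)
  ultimately have "(\<lambda>k. residual (Suc k)) \<longlonglongrightarrow> 0"
    by simp
  then have feasible: "X *v \<beta>' + r' - y = 0"
    using LIMSEQ_unique[OF LIMSEQ_Suc[OF res_lim]] by blast
  have "prox_slope \<longlonglongrightarrow> transpose X *v (d' - \<mu> *\<^sub>R (X *v \<beta>' + r' - y)) - \<eta> *\<^sub>R (\<beta>' - \<beta>')"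
    unfolding prox_slope_def[abs_def] by (intro tendsto_intros X_lim LIMSEQ_Suc lim d_lim res_lim)
  then have slope_lim: "prox_slope \<longlonglongrightarrow> transpose X *v d'"
    by (simp add: feasible del: transpose_matrix_vector)
  have cont: "isCont (\<lambda>x. P \<bar>x\<bar>) x" for x
    using pen by (auto simp: piecewise_quadratic_penalty_def continuous_on_eq_continuous_at)
  have "(\<lambda>k. vec_penalty P (\<beta> (Suc k))) \<longlonglongrightarrow> vec_penalty P \<beta>'"
    unfolding vec_penalty_def
    by (intro tendsto_sum isCont_tendsto_compose[OF cont] tendsto_vec_nth LIMSEQ_Suc lim)
  moreover have "prox_slope k \<in> regular_subdiff (vec_penalty P) (\<beta> (Suc k))" for k
    by (rule proximal_imp_regular_subdiff[OF prox_inequality])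
  ultimately have "transpose X *v d' \<in> limiting_subdiff (vec_penalty P) \<beta>'"
    unfolding limiting_subdiff_def using LIMSEQ_Suc[OF lim(1)] slope_lim by blast
  then show ?thesis
    using lim d_lim feasible gderiv_vec_loss[OF loss, of r'] unfolding critical_point_def d'_def by blast
qed

end

theorem theorem2:
  fixes X :: "real ^ 'p ^ 'n" and y :: "real ^ 'n"
    and \<L> q :: "real \<Rightarrow> real"
    and \<tau> c \<kappa> l1 l2 a mu_low \<mu> \<eta> :: real
    and \<beta> :: "nat \<Rightarrow> real ^ 'p" and r d :: "nat \<Rightarrow> real ^ 'n"
  assumes "0 < \<tau>" "\<tau> < 1" "c > 0" "\<kappa> > 0" "\<mu> > 0" "\<eta> > 0"
    and loss: "\<L> = quantile_loss_c \<tau> c \<or> \<L> = quantile_loss_kappa \<tau> \<kappa>"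
    and "l1 > 0" "l2 \<ge> 0"
    and penalty: "(a > 2 \<and> q = scad l1 a) \<or> (a > 1 \<and> q = mcp l1 a) \<or> (a > 0 \<and> q = capped_l1 l1 a)"
    and "mu_low > 0" "positive_definite (transpose X ** X - mu_low *\<^sub>R mat 1)"
    and initial: "feasible X y (\<beta> 0) (r 0)"
    and algorithm:
      "ladmm X y \<L> (penalty q l2) \<mu> \<eta> \<beta> r d \<or>
       (\<exists>M B. row_partition M B \<and> parallel_ladmm M B X y \<L> (penalty q l2) \<mu> \<eta> \<beta> r d)"
    and "\<mu> > sqrt (2 * real CARD('n)) / min c \<kappa>"
    and "\<eta> > max_eigenvalue (\<mu> *\<^sub>R (transpose X ** X))"
  shows "\<exists>\<beta>' r' d'. \<beta> \<longlonglongrightarrow> \<beta>' \<and> r \<longlonglongrightarrow> r' \<and> d \<longlonglongrightarrow> d' \<and>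
           critical_point X y \<L> (penalty q l2) \<beta>' r' d'"
proof -
  obtain L' where L': "smooth_piecewise_quadratic (1 / min c \<kappa>) \<L> L'"
    using smooth_piecewise_quadratic_quantile_loss assms(1-4) loss by blast
  have pen: "piecewise_quadratic_penalty (\<lambda>x. penalty q l2 \<bar>x\<bar>)"
    using penalty \<open>l1 > 0\<close> \<open>l2 \<ge> 0\<close> piecewise_quadratic_scad piecewise_quadratic_mcp
      piecewise_quadratic_capped_l1 by blast
  define A where "A = \<mu> *\<^sub>R (transpose X ** X)"
  have A: "A *v u = \<mu> *\<^sub>R (transpose X *v (X *v u))" for u
    unfolding A_def by (simp only: scaleR_matrix_vector_assoc matrix_vector_mul_assoc)
  have inner_A: "u \<bullet> (A *v v) = \<mu> * ((X *v u) \<bullet> (X *v v))" for u v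
    unfolding A inner_scaleR_right inner_commute[of u] inner_transpose_mult
    by (simp only: inner_commute)
  have "v \<bullet> (A *v v) \<le> max_eigenvalue A * (norm v)\<^sup>2" for v
    by (rule inner_le_max_eigenvalue) (metis inner_A inner_commute)
  \<comment> \<open>The spectral gap \<open>\<eta> - max_eigenvalue A\<close> serves as
    \<open>\<sigma>\<close>.\<close>
  then have coercive: "\<mu> * (norm (X *v v))\<^sup>2 + (\<eta> - max_eigenvalue A) * (norm v)\<^sup>2 \<le> \<eta> * (norm v)\<^sup>2" for v
    by (simp add: inner_A power2_norm_eq_inner algebra_simps)
  \<comment> \<open>As there is at least one row, the threshold on \<open>\<mu>\<close> yields
    \<open>2 * l\<^sup>2 < \<mu>\<^sup>2\<close> for \<open>l = 1 / min c \<kappa>\<close>.\<close>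
  have "sqrt 2 \<le> sqrt (2 * real CARD('n))"
    by (simp add: Suc_le_eq)
  then have "sqrt 2 / min c \<kappa> \<le> sqrt (2 * real CARD('n)) / min c \<kappa>"
    using assms(3,4) by (intro divide_right_mono) auto
  then have "sqrt 2 * (1 / min c \<kappa>) < \<mu>"
    using assms(15) by simp
  then have "(sqrt 2 * (1 / min c \<kappa>))\<^sup>2 < \<mu>\<^sup>2"
    using assms(3,4) by (intro power_strict_mono) auto
  then have \<mu>: "2 * (1 / min c \<kappa>)\<^sup>2 < \<mu>\<^sup>2"
    by (simp add: power_mult_distrib power_divide)
  have "\<L> 0 = 0"
    using L' by (simp add: smooth_piecewise_quadratic_def)
  then have "ladmm X y \<L> (penalty q l2) \<mu> \<eta> \<beta> r d"
    using algorithm parallel_ladmm_imp_ladmm by blast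
  then interpret ladmm_iteration X y \<L> L' "penalty q l2" "1 / min c \<kappa>" \<mu> \<eta> "\<eta> - max_eigenvalue A" \<beta> r d
    using L' pen \<mu> coercive assms(3-6) assms(16) by unfold_locales (auto simp: A_def)
  show ?thesis
    by (rule converges_to_critical_point)
qed

end
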